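(* (i) Let $X$ be a finite set and let $(X,S)$ be a non-degenerate, involutive and braided set-theoretical solution of the quantum Yang-Baxter equation. Then the structure group of $(X,S)$ is a Garside group. (ii) Conversely, let $X$ be a finite non-empty set of cardinality $n$, and assume that $\operatorname{Mon}\langle X\mid R\rangle$ is a Garside monoid such that: - the cardinality of $R$ is $n(n-1)/2$ and each side of a relation in $R$ is a word of length $2$ in the letters of $X$; and - if a word $x_ix_j$ (with $x_i,x_j\in X$) appears in $R$, then it appears only once (i.e. it occurs as a side of a relation of $R$ exactly once). Then there exists a function $S:X\times X\to X\times X$ such that $(X,S)$ is a non-degenerate, involutive and braided set-theoretical solution and $\operatorname{Gp}\langle X\mid R\rangle$ is its structure group.
   Context: Set-theoretical solutions. A set-theoretical solution (of the quantum Yang-Baxter equation) is a pair $(X,S)$ with $X$ a non-empty set and $S:X^2\to X^2$ a bijection; write $S(x,y)=(S_1(x,y),S_2(x,y))$. It is non-degenerate if for all fixed $y,z\in X$ the maps $x\mapsto S_2(x,y)$ and $x\mapsto S_1(z,x)$ are bijections $X\to X$; involutive if $S^2=\mathrm{id}_{X^2}$; braided if $S^{12}S^{23}S^{12}=S^{23}S^{12}S^{23}$ on $X^3$, where $S^{12}=S\times \mathrm{id}_X$ and $S^{23}=\mathrm{id}_X\times S$. The structure group of $(X,S)$ is the group generated by $X$ with defining relations $xy=tz$ whenever $S(x,y)=(t,z)$. Garside monoids and groups. $\operatorname{Mon}\langle X\mid R\rangle$ and $\operatorname{Gp}\langle X\mid R\rangle$ denote the monoid and the group presented by generators $X$ and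 relations $R$. In a monoid $M$, $x$ is a left divisor of $z$ if $z=xt$ for some $t\in M$; $z$ is a right lcm of $x,y$ if $x,y$ are left divisors of $z$ and $z$ is a left divisor of every $w$ having $x$ and $y$ as left divisors; right divisors, left lcm, and left and right gcd are defined analogously. An atom is an element $x\ne 1$ such that $x=yz$ implies $y=1$ or $z=1$. $M$ is atomic if it is generated by its atoms and for every $x\in M$ the supremum of the lengths of decompositions of $x$ as products of atoms is finite. $M$ is Gaussian if it is atomic, left and right cancellative, and any two elements have a left and a right gcd and a left and a right lcm. A Garside element is $\Delta\in M$ whose left divisors coincide with its right divisors, are finite in number, and generate $M$. $M$ is Garside if it is Gaussian and contains a Garside element. A Garside group is the group of fractions of a Garside monoid. *)

theory Defs
  imports "HOL-Algebra.Divisibility"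
begin

section \<open>Monoid and group presentations\<close>

inductive_set word_cong :: "'a set \<Rightarrow> ('a list \<times> 'a list) set \<Rightarrow> ('a list \<times> 'a list) set"
  for X :: "'a set" and R :: "('a list \<times> 'a list) set"
  where
    rel: "(u, v) \<in> R \<Longrightarrow> u \<in> lists X \<Longrightarrow> v \<in> lists X \<Longrightarrow> (u, v) \<in> word_cong X R"
  | refl: "u \<in> lists X \<Longrightarrow> (u, u) \<in> word_cong X R"
  | sym: "(u, v) \<in> word_cong X R \<Longrightarrow> (v, u) \<in> word_cong X R"
  | trans: "(u, v) \<in> word_cong X R \<Longrightarrow> (v, w) \<in> word_cong X R \<Longrightarrow> (u, w) \<in> word_cong X R"
  | append: "(u, v) \<in> word_cong X R \<Longrightarrow> (u', v') \<in> word_cong X R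
      \<Longrightarrow> (u @ u', v @ v') \<in> word_cong X R"

text \<open>
  The presented monoid is the quotient of the free monoid of words over \<open>X\<close> by the least
  congruence containing \<open>R\<close>.  The union in the product only makes it independent of
  representatives: on two classes it is the class of the concatenation
  (lemma \<open>presented_monoid_mult\<close> below).
\<close>

definition presented_monoid ::
    "'a set \<Rightarrow> ('a list \<times> 'a list) set \<Rightarrow> 'a list set monoid"
  where "presented_monoid X R =
    \<lparr>carrier = lists X // word_cong X R,
     mult = (\<lambda>A B. \<Union>u\<in>A. \<Union>v\<in>B. word_cong X R `` {u @ v}),
     one = word_cong X R `` {[]}\<rparr>"

text \<open>
  The presented group with generators \<open>X\<close> and relations \<open>R\<close> between positive words is the monoid
  of words in signed letters, where \<open>(x, True)\<close> stands for \<open>x\<close> and \<open>(x, False)\<close> for its formal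
  inverse, modulo \<open>R\<close> and the relations making these two letters mutually inverse.
\<close>

definition group_relations ::
    "'a set \<Rightarrow> ('a list \<times> 'a list) set \<Rightarrow> (('a \<times> bool) list \<times> ('a \<times> bool) list) set"
  where "group_relations X R =
    {(map (\<lambda>x. (x, True)) u, map (\<lambda>x. (x, True)) v) | u v. (u, v) \<in> R}
    \<union> {([(x, e), (x, \<not> e)], []) | x e. x \<in> X}"

definition presented_group ::
    "'a set \<Rightarrow> ('a list \<times> 'a list) set \<Rightarrow> ('a \<times> bool) list set monoid"
  where "presented_group X R = presented_monoid (X \<times> UNIV) (group_relations X R)"

lemma word_cong_lists: "(u, v) \<in> word_cong X R \<Longrightarrow> u \<in> lists X \<and> v \<in> lists X"
  by (induction rule: word_cong.induct) auto

lemma equiv_word_cong: "equiv (lists X) (word_cong X R)"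
proof (rule equivI)
  show "word_cong X R \<subseteq> lists X \<times> lists X" using word_cong_lists by fast
  show "refl_on (lists X) (word_cong X R)" by (auto simp: refl_on_def intro: word_cong.refl)
  show "sym (word_cong X R)" by (auto intro: symI word_cong.sym)
  show "trans (word_cong X R)" by (rule transI) (rule word_cong.trans)
qed

lemma presented_monoid_carrier:
  "carrier (presented_monoid X R) = {word_cong X R `` {u} | u. u \<in> lists X}"
  by (auto simp: presented_monoid_def quotient_def)

lemma presented_monoid_mult:
  assumes "u \<in> lists X" "v \<in> lists X"
  shows "word_cong X R `` {u} \<otimes>\<^bsub>presented_monoid X R\<^esub> word_cong X R `` {v}
    = word_cong X R `` {u @ v}"
proof -
  have eq: "word_cong X R `` {u' @ v'} = word_cong X R `` {u @ v}"
    if "(u, u') \<in> word_cong X R" "(v, v') \<in> word_cong X R" for u' v'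
    using equiv_class_eq[OF equiv_word_cong word_cong.append[OF that]] by simp
  have "u \<in> word_cong X R `` {u}" "v \<in> word_cong X R `` {v}"
    using assms by (auto intro: word_cong.refl)
  then have "(\<Union>u'\<in>word_cong X R `` {u}. \<Union>v'\<in>word_cong X R `` {v}.
      word_cong X R `` {u' @ v'}) = word_cong X R `` {u @ v}"
    using eq by blast
  then show ?thesis by (simp add: presented_monoid_def)
qed

lemma monoid_presented_monoid: "monoid (presented_monoid X R)"
proof -
  have one: "\<one>\<^bsub>presented_monoid X R\<^esub> = word_cong X R `` {[]}"
    by (simp add: presented_monoid_def)
  show ?thesis
  proof (rule monoidI)
    fix A B assume "A \<in> carrier (presented_monoid X R)" "B \<in> carrier (presented_monoid X R)"
    then obtain u v where "u \<in> lists X" "v \<in> lists X"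
      "A = word_cong X R `` {u}" "B = word_cong X R `` {v}"
      by (auto simp: presented_monoid_carrier)
    then show "A \<otimes>\<^bsub>presented_monoid X R\<^esub> B \<in> carrier (presented_monoid X R)"
      unfolding presented_monoid_carrier
      using presented_monoid_mult[of u X v R] append_in_lists_conv[of u v X] by blast
  next
    show "\<one>\<^bsub>presented_monoid X R\<^esub> \<in> carrier (presented_monoid X R)"
      unfolding presented_monoid_carrier one by blast
  next
    fix A B C assume "A \<in> carrier (presented_monoid X R)" "B \<in> carrier (presented_monoid X R)"
      "C \<in> carrier (presented_monoid X R)"
    then obtain u v w where "u \<in> lists X" "v \<in> lists X" "w \<in> lists X"
      "A = word_cong X R `` {u}" "B = word_cong X R `` {v}" "C = word_cong X R `` {w}"
      by (auto simp: presented_monoid_carrier)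
    then show "A \<otimes>\<^bsub>presented_monoid X R\<^esub> B \<otimes>\<^bsub>presented_monoid X R\<^esub> C
        = A \<otimes>\<^bsub>presented_monoid X R\<^esub> (B \<otimes>\<^bsub>presented_monoid X R\<^esub> C)"
      by (simp only: presented_monoid_mult append_in_lists_conv append_assoc simp_thms)
  next
    fix A assume "A \<in> carrier (presented_monoid X R)"
    then obtain u where u: "u \<in> lists X" "A = word_cong X R `` {u}"
      by (auto simp: presented_monoid_carrier)
    show "\<one>\<^bsub>presented_monoid X R\<^esub> \<otimes>\<^bsub>presented_monoid X R\<^esub> A = A"
      unfolding one u(2) using presented_monoid_mult[of "[]" X u R] u by simp
    show "A \<otimes>\<^bsub>presented_monoid X R\<^esub> \<one>\<^bsub>presented_monoid X R\<^esub> = A"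
      unfolding one u(2) using presented_monoid_mult[of u X "[]" R] u by simp
  qed
qed

lemma group_presented_group: "group (presented_group X R)"
proof -
  define Y where "Y = X \<times> (UNIV :: bool set)"
  define Q where "Q = group_relations X R"
  have inv: "\<exists>v \<in> lists Y. (v @ u, []) \<in> word_cong Y Q" if "u \<in> lists Y" for u
    using that
  proof (induction u)
    case Nil
    then show ?case by (intro bexI[of _ "[]"]) (auto intro: word_cong.refl)
  next
    case (Cons a u)
    then obtain v where v: "v \<in> lists Y" "(v @ u, []) \<in> word_cong Y Q" by auto
    obtain x e where a: "a = (x, e)" "x \<in> X" using Cons.hyps by (auto simp: Y_def)
    have "([(x, \<not> e), a], []) \<in> word_cong Y Q"
    proof (rule word_cong.rel)
      show "([(x, \<not> e), a], []) \<in> Q"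
        unfolding Q_def group_relations_def a(1) using a(2)
        by (intro UnI2 CollectI exI[of _ x] exI[of _ "\<not> e"]) simp
    qed (use a in \<open>auto simp: Y_def\<close>)
    moreover have "(v, v) \<in> word_cong Y Q" "(u, u) \<in> word_cong Y Q"
      using v Cons.hyps by (auto intro: word_cong.refl)
    ultimately have "(v @ ([(x, \<not> e), a] @ u), v @ ([] @ u)) \<in> word_cong Y Q"
      by (blast intro: word_cong.append)
    then have "((v @ [(x, \<not> e)]) @ (a # u), []) \<in> word_cong Y Q"
      using v(2) by (auto intro: word_cong.trans)
    moreover have "v @ [(x, \<not> e)] \<in> lists Y" using v a by (auto simp: Y_def)
    ultimately show ?case by blast
  qed
  interpret M: monoid "presented_monoid Y Q" by (rule monoid_presented_monoid)
  have "group (presented_monoid Y Q)"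
  proof (rule groupI)
    fix A assume "A \<in> carrier (presented_monoid Y Q)"
    then obtain u where u: "u \<in> lists Y" "A = word_cong Y Q `` {u}"
      by (auto simp: presented_monoid_carrier)
    obtain v where v: "v \<in> lists Y" "(v @ u, []) \<in> word_cong Y Q" using inv u by blast
    have "word_cong Y Q `` {v} \<otimes>\<^bsub>presented_monoid Y Q\<^esub> A = \<one>\<^bsub>presented_monoid Y Q\<^esub>"
      unfolding u(2) presented_monoid_mult[OF v(1) u(1)] equiv_class_eq[OF equiv_word_cong v(2)]
      by (simp add: presented_monoid_def)
    then show "\<exists>B\<in>carrier (presented_monoid Y Q).
        B \<otimes>\<^bsub>presented_monoid Y Q\<^esub> A = \<one>\<^bsub>presented_monoid Y Q\<^esub>"
      using v(1) unfolding presented_monoid_carrier by blast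
  qed (simp_all add: M.m_assoc)
  then show ?thesis unfolding presented_group_def Y_def Q_def .
qed


section \<open>Garside monoids and groups\<close>

text \<open>
  The library relation \<open>a divides\<^bsub>M\<^esub> b\<close>, i.e. \<open>b \<in> a \<otimes>\<^bsub>M\<^esub> carrier M\<close>, is left divisibility; in
  a non-commutative monoid the library's \<open>lcmof\<close> is therefore the right lcm and \<open>gcdof\<close> the left
  gcd.  The other-sided notions are those of the opposite monoid.
\<close>

definition opposite :: "'a monoid \<Rightarrow> 'a monoid"
  where "opposite M = \<lparr>carrier = carrier M, mult = (\<lambda>x y. y \<otimes>\<^bsub>M\<^esub> x), one = \<one>\<^bsub>M\<^esub>\<rparr>"

definition left_divisor :: "'a monoid \<Rightarrow> 'a \<Rightarrow> 'a \<Rightarrow> bool"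
  where "left_divisor M x z \<longleftrightarrow> x divides\<^bsub>M\<^esub> z"

definition right_divisor :: "'a monoid \<Rightarrow> 'a \<Rightarrow> 'a \<Rightarrow> bool"
  where "right_divisor M x z \<longleftrightarrow> x divides\<^bsub>opposite M\<^esub> z"

definition right_lcm :: "'a monoid \<Rightarrow> 'a \<Rightarrow> 'a \<Rightarrow> 'a \<Rightarrow> bool"
  where "right_lcm M z x y \<longleftrightarrow> z lcmof\<^bsub>M\<^esub> x y"

definition left_lcm :: "'a monoid \<Rightarrow> 'a \<Rightarrow> 'a \<Rightarrow> 'a \<Rightarrow> bool"
  where "left_lcm M z x y \<longleftrightarrow> z lcmof\<^bsub>opposite M\<^esub> x y"

definition left_gcd :: "'a monoid \<Rightarrow> 'a \<Rightarrow> 'a \<Rightarrow> 'a \<Rightarrow> bool"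
  where "left_gcd M z x y \<longleftrightarrow> z gcdof\<^bsub>M\<^esub> x y"

definition right_gcd :: "'a monoid \<Rightarrow> 'a \<Rightarrow> 'a \<Rightarrow> 'a \<Rightarrow> bool"
  where "right_gcd M z x y \<longleftrightarrow> z gcdof\<^bsub>opposite M\<^esub> x y"

definition product :: "'a monoid \<Rightarrow> 'a list \<Rightarrow> 'a"
  where "product M xs = foldr (\<otimes>\<^bsub>M\<^esub>) xs \<one>\<^bsub>M\<^esub>"

definition generates :: "'a monoid \<Rightarrow> 'a set \<Rightarrow> bool"
  where "generates M A \<longleftrightarrow> A \<subseteq> carrier M \<and> (\<forall>x\<in>carrier M. \<exists>xs\<in>lists A. product M xs = x)"

definition atoms :: "'a monoid \<Rightarrow> 'a set"
  where "atoms M = {x \<in> carrier M. x \<noteq> \<one>\<^bsub>M\<^esub> \<and>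
    (\<forall>y\<in>carrier M. \<forall>z\<in>carrier M. x = y \<otimes>\<^bsub>M\<^esub> z \<longrightarrow> y = \<one>\<^bsub>M\<^esub> \<or> z = \<one>\<^bsub>M\<^esub>)}"

definition atomic_monoid :: "'a monoid \<Rightarrow> bool"
  where "atomic_monoid M \<longleftrightarrow> monoid M \<and> generates M (atoms M) \<and>
    (\<forall>x\<in>carrier M. bdd_above {length xs | xs. xs \<in> lists (atoms M) \<and> product M xs = x})"

definition gaussian_monoid :: "'a monoid \<Rightarrow> bool"
  where "gaussian_monoid M \<longleftrightarrow> atomic_monoid M \<and> monoid_cancel M \<and>
    (\<forall>x\<in>carrier M. \<forall>y\<in>carrier M.
      (\<exists>z\<in>carrier M. left_gcd M z x y) \<and> (\<exists>z\<in>carrier M. right_gcd M z x y) \<and>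
      (\<exists>z\<in>carrier M. left_lcm M z x y) \<and> (\<exists>z\<in>carrier M. right_lcm M z x y))"

definition garside_element :: "'a monoid \<Rightarrow> 'a \<Rightarrow> bool"
  where "garside_element M d \<longleftrightarrow> d \<in> carrier M \<and>
    {x \<in> carrier M. left_divisor M x d} = {x \<in> carrier M. right_divisor M x d} \<and>
    finite {x \<in> carrier M. left_divisor M x d} \<and>
    generates M {x \<in> carrier M. left_divisor M x d}"

definition garside_monoid :: "'a monoid \<Rightarrow> bool"
  where "garside_monoid M \<longleftrightarrow> gaussian_monoid M \<and> (\<exists>d. garside_element M d)"

text \<open>
  \<open>G\<close> is a group of fractions of \<open>M\<close> if \<open>M\<close> embeds into \<open>G\<close> and every element of \<open>G\<close> is a right
  fraction of elements of the image.  For a Gaussian monoid the Ore conditions hold on both sides,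
  so this determines \<open>G\<close> up to isomorphism, and left fractions give the same notion.
\<close>

definition group_of_fractions :: "'g monoid \<Rightarrow> 'm monoid \<Rightarrow> bool"
  where "group_of_fractions G M \<longleftrightarrow> group G \<and>
    (\<exists>f \<in> hom M G. f \<one>\<^bsub>M\<^esub> = \<one>\<^bsub>G\<^esub> \<and> inj_on f (carrier M) \<and>
      (\<forall>g\<in>carrier G. \<exists>a\<in>carrier M. \<exists>b\<in>carrier M. g = f a \<otimes>\<^bsub>G\<^esub> inv\<^bsub>G\<^esub> (f b)))"

text \<open>
  Since \<open>M\<close> embeds into \<open>G\<close>, it is no restriction that its elements have the same type as
  those of \<open>G\<close>.
\<close>

definition garside_group :: "'g monoid \<Rightarrow> bool"
  where "garside_group G \<longleftrightarrow> (\<exists>M :: 'g monoid. garside_monoid M \<and> group_of_fractions G M)"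


section \<open>Set-theoretical solutions of the quantum Yang-Baxter equation\<close>

text \<open>
  A map \<open>S : X\<^sup>2 \<rightarrow> X\<^sup>2\<close> is a total function of which only the values on \<open>X \<times> X\<close> matter; its
  components are \<open>S\<^sub>1 = fst \<circ> S\<close> and \<open>S\<^sub>2 = snd \<circ> S\<close>.
\<close>

definition set_solution :: "'a set \<Rightarrow> ('a \<times> 'a \<Rightarrow> 'a \<times> 'a) \<Rightarrow> bool"
  where "set_solution X S \<longleftrightarrow> X \<noteq> {} \<and> bij_betw S (X \<times> X) (X \<times> X)"

definition non_degenerate :: "'a set \<Rightarrow> ('a \<times> 'a \<Rightarrow> 'a \<times> 'a) \<Rightarrow> bool"
  where "non_degenerate X S \<longleftrightarrow>
    (\<forall>y\<in>X. bij_betw (\<lambda>x. snd (S (x, y))) X X) \<and>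
    (\<forall>z\<in>X. bij_betw (\<lambda>x. fst (S (z, x))) X X)"

definition involutive :: "'a set \<Rightarrow> ('a \<times> 'a \<Rightarrow> 'a \<times> 'a) \<Rightarrow> bool"
  where "involutive X S \<longleftrightarrow> (\<forall>p\<in>X \<times> X. S (S p) = p)"

definition S12 :: "('a \<times> 'a \<Rightarrow> 'a \<times> 'a) \<Rightarrow> 'a \<times> 'a \<times> 'a \<Rightarrow> 'a \<times> 'a \<times> 'a"
  where "S12 S = (\<lambda>(x, y, z). (fst (S (x, y)), snd (S (x, y)), z))"

definition S23 :: "('a \<times> 'a \<Rightarrow> 'a \<times> 'a) \<Rightarrow> 'a \<times> 'a \<times> 'a \<Rightarrow> 'a \<times> 'a \<times> 'a"
  where "S23 S = (\<lambda>(x, y, z). (x, S (y, z)))"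

definition braided :: "'a set \<Rightarrow> ('a \<times> 'a \<Rightarrow> 'a \<times> 'a) \<Rightarrow> bool"
  where "braided X S \<longleftrightarrow> (\<forall>p \<in> X \<times> X \<times> X.
    (S12 S \<circ> S23 S \<circ> S12 S) p = (S23 S \<circ> S12 S \<circ> S23 S) p)"

definition structure_relations :: "'a set \<Rightarrow> ('a \<times> 'a \<Rightarrow> 'a \<times> 'a) \<Rightarrow> ('a list \<times> 'a list) set"
  where "structure_relations X S =
    {([x, y], [t, z]) | x y t z. x \<in> X \<and> y \<in> X \<and> S (x, y) = (t, z)}"

definition structure_group ::
    "'a set \<Rightarrow> ('a \<times> 'a \<Rightarrow> 'a \<times> 'a) \<Rightarrow> ('a \<times> bool) list set monoid"
  where "structure_group X S = presented_group X (structure_relations X S)"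

end

theory Submission
  imports Defs
begin

text \<open>
  \<^emph>\<open>From solutions to Garside groups.\<close>  Write \<open>\<sigma>\<^sub>x(y)\<close> for the first component of \<open>S(x, y)\<close>.
  For an involutive non-degenerate \<open>S\<close> the braid equation amounts to \<open>\<sigma>\<^sub>x \<sigma>\<^sub>y = \<sigma>\<^sub>t \<sigma>\<^sub>z\<close> whenever
  \<open>S(x, y) = (t, z)\<close>, as \<open>perm_law_if_braided\<close> and \<open>braided_if_perm_law\<close> show.  This law
  says that letting \<open>x\<close> act on \<open>\<int>\<^sup>X\<close> by the affine map \<open>f \<mapsto> e\<^sub>x + \<sigma>\<^sub>x \<cdot> f\<close> defines an action of
  the structure group.  The orbit map of \<open>0\<close> is a cocycle, and it identifies the
  submonoid of positive words with \<open>\<nat>\<^sup>X\<close> (\<open>coords_surj\<close>, \<open>word_cong_if_coords_eq\<close>).  Since the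
  linear parts only permute coordinates, left divisibility becomes the componentwise order
  (\<open>divides_pos_iff\<close>), which is a lattice.  Nothing comparable is visible for right divisors, but
  they need no second coordinate system: the elements with coordinates \<open>(k, \<dots>, k)\<close> have the same
  left and right divisors, and in a cancellative graded monoid with enough such elements the
  right-hand lattice operations follow from the left-hand ones
  (\<open>garside_if_left_gcd_and_balanced\<close>).  The vector \<open>(1, \<dots>, 1)\<close> gives the Garside element, and
  common multiples turn every group element into a fraction.

  \<^emph>\<open>From Garside monoids to solutions.\<close>  Each relation \<open>xa = yb\<close> has \<open>x \<noteq> y\<close> and \<open>a \<noteq> b\<close> by
  cancellation, and \<open>xa\<close> must be the right lcm of \<open>x, y\<close> and the left lcm of \<open>a, b\<close>, for degree
  reasons.  So no pair \<open>{x, y}\<close> is served by two relations, and as there are as many relations as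
  pairs, every pair is served by exactly one, on the left as well as on the right.  Exchanging the
  two sides of every relation and fixing all other words of length two therefore gives a
  non-degenerate involution.  The braid equation is again the law \<open>\<sigma>\<^sub>x \<sigma>\<^sub>a = \<sigma>\<^sub>y \<sigma>\<^sub>b\<close>.  At an argument
  \<open>c\<close> whose image \<open>z\<close> under \<open>\<sigma>\<^sub>x \<sigma>\<^sub>a\<close> is neither \<open>x\<close> nor \<open>y\<close>, the word \<open>xac\<close> is a common multiple of
  \<open>x\<close>, \<open>y\<close>, \<open>z\<close>, and divisibility by the lcm of \<open>y\<close> and \<open>z\<close> forces the equality (\<open>perm_agree\<close>).  The
  two remaining arguments escape this argument, because they involve words outside the relations;
  there the equality comes from bijectivity (\<open>bij_betw_agree\<close>).
\<close>

section \<open>Monoids with a degree\<close>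

text \<open>
  An additive degree that vanishes only at the identity replaces all appeals to noetherianity.
\<close>

locale graded_monoid = monoid M for M :: "'m monoid" (structure) +
  fixes deg :: "'m \<Rightarrow> nat"
  assumes deg_mult: "a \<in> carrier M \<Longrightarrow> b \<in> carrier M \<Longrightarrow> deg (a \<otimes> b) = deg a + deg b"
    and deg_zero: "a \<in> carrier M \<Longrightarrow> deg a = 0 \<Longrightarrow> a = \<one>"
begin

lemma divides_deg_le: "a divides b \<Longrightarrow> a \<in> carrier M \<Longrightarrow> deg a \<le> deg b"
  by (auto simp: factor_def deg_mult)

lemma divides_deg_eq:
  assumes "a divides b" "a \<in> carrier M" "deg b \<le> deg a"
  shows "a = b"
proof -
  obtain c where c: "c \<in> carrier M" "b = a \<otimes> c" using assms(1) by (auto simp: factor_def)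
  then have "c = \<one>" using assms by (intro deg_zero) (simp_all add: deg_mult)
  then show ?thesis using c assms(2) by simp
qed

lemma product_closed: "xs \<in> lists (carrier M) \<Longrightarrow> product M xs \<in> carrier M"
  by (induction xs) (auto simp: product_def)

lemma product_append:
  "xs \<in> lists (carrier M) \<Longrightarrow> ys \<in> lists (carrier M)
    \<Longrightarrow> product M (xs @ ys) = product M xs \<otimes> product M ys"
proof (induction xs)
  case Nil
  then show ?case using product_closed by (simp add: product_def)
next
  case (Cons x xs)
  then show ?case
    using product_closed[of xs] product_closed[of ys] by (auto simp: product_def m_assoc)
qed

lemma atoms_subset: "atoms M \<subseteq> carrier M"
  by (auto simp: atoms_def)

lemma atoms_generate: "a \<in> carrier M \<Longrightarrow> \<exists>xs\<in>lists (atoms M). product M xs = a"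
proof (induction "deg a" arbitrary: a rule: less_induct)
  case less
  consider "a = \<one>" | "a \<in> atoms M"
    | b c where "b \<in> carrier M" "c \<in> carrier M" "a = b \<otimes> c" "b \<noteq> \<one>" "c \<noteq> \<one>"
    using less.prems by (auto simp: atoms_def)
  then show ?case
  proof cases
    case 1
    then show ?thesis by (intro bexI[of _ "[]"]) (auto simp: product_def)
  next
    case 2
    then show ?thesis using less.prems by (intro bexI[of _ "[a]"]) (auto simp: product_def)
  next
    case 3
    then have "deg b < deg a" "deg c < deg a" using deg_zero by (auto simp: deg_mult)
    then obtain xs ys where "xs \<in> lists (atoms M)" "product M xs = b"
      "ys \<in> lists (atoms M)" "product M ys = c"
      using less.hyps 3 by metis
    moreover from this have "product M (xs @ ys) = a"
      using 3 product_append[of xs ys] lists_mono[OF atoms_subset] by auto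
    ultimately show ?thesis by (intro bexI[of _ "xs @ ys"]) auto
  qed
qed

lemma length_le_deg_product: "xs \<in> lists (atoms M) \<Longrightarrow> length xs \<le> deg (product M xs)"
proof (induction xs)
  case (Cons x xs)
  have x: "x \<in> carrier M" "x \<noteq> \<one>" using Cons.prems by (auto simp: atoms_def)
  have xs: "product M xs \<in> carrier M"
    using Cons.prems lists_mono[OF atoms_subset] by (intro product_closed) auto
  have "product M (x # xs) = x \<otimes> product M xs" by (simp add: product_def)
  moreover have "deg x \<noteq> 0" using x deg_zero by blast
  ultimately show ?case using Cons deg_mult[OF x(1) xs] by simp
qed simp

lemma atomic: "atomic_monoid M"
  unfolding atomic_monoid_def generates_def
proof (intro conjI ballI)
  show "monoid M" by (rule monoid_axioms)
  show "atoms M \<subseteq> carrier M" by (rule atoms_subset)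
  show "\<exists>xs\<in>lists (atoms M). product M xs = x" if "x \<in> carrier M" for x
    by (rule atoms_generate[OF that])
  show "bdd_above {length xs | xs. xs \<in> lists (atoms M) \<and> product M xs = x}" for x
    using length_le_deg_product by (intro bdd_aboveI[of _ "deg x"]) auto
qed

text \<open>
  A common multiple of least degree is an lcm: its gcd with any other common multiple is a common
  multiple of no larger degree, hence equal to it.
\<close>

lemma lcm_if_gcd:
  assumes gcd: "\<And>a b. a \<in> carrier M \<Longrightarrow> b \<in> carrier M \<Longrightarrow> \<exists>d\<in>carrier M. d gcdof a b"
    and ab: "a \<in> carrier M" "b \<in> carrier M"
    and c: "c \<in> carrier M" "a divides c" "b divides c"
  shows "\<exists>m\<in>carrier M. m lcmof a b"
proof -
  define P where "P = (\<lambda>m. m \<in> carrier M \<and> a divides m \<and> b divides m)"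
  define m where "m = arg_min deg P"
  have m: "P m" "\<And>m'. P m' \<Longrightarrow> deg m \<le> deg m'"
    unfolding m_def using arg_min_nat_lemma[of P c deg] c by (auto simp: P_def)
  have "m divides m'" if m': "m' \<in> carrier M" "a divides m'" "b divides m'" for m'
  proof -
    obtain d where d: "d \<in> carrier M" "d gcdof m m'" using gcd m(1) m' by (auto simp: P_def)
    have "P d" using ab d m(1) m' by (auto simp: P_def isgcd_def)
    then have "deg m \<le> deg d" by (rule m(2))
    moreover have "d divides m" "d divides m'" using d by (auto simp: isgcd_def)
    ultimately show ?thesis using divides_deg_eq[of d m] d by simp
  qed
  then show ?thesis using m(1) by (auto simp: P_def islcm_def)
qed

text \<open>
  The lcm of two distinct elements of degree one has degree at least two.
\<close>

lemma lcm_of_degree_one: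
  assumes xy: "x \<in> carrier M" "y \<in> carrier M" "deg x = 1" "deg y = 1" "x \<noteq> y"
    and w: "w \<in> carrier M" "w lcmof x y"
    and v: "v \<in> carrier M" "x divides v" "y divides v" "deg v = 2"
  shows "w = v"
proof -
  have wv: "w divides v" and xw: "x divides w" "y divides w" using w v by (auto simp: islcm_def)
  have "2 \<le> deg w"
  proof (rule ccontr)
    assume "\<not> 2 \<le> deg w"
    then have "x = w" "y = w" using xw xy by (auto intro!: divides_deg_eq)
    then show False using xy by simp
  qed
  then show ?thesis using divides_deg_eq[OF wv] w v by simp
qed

end

lemma opposite_simps [simp]:
  "carrier (opposite M) = carrier M" "\<one>\<^bsub>opposite M\<^esub> = \<one>\<^bsub>M\<^esub>"
  "a \<otimes>\<^bsub>opposite M\<^esub> b = b \<otimes>\<^bsub>M\<^esub> a"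
  by (simp_all add: opposite_def)

lemma graded_monoid_opposite:
  assumes "graded_monoid M deg"
  shows "graded_monoid (opposite M) deg"
proof -
  interpret graded_monoid M deg by fact
  show ?thesis
    by unfold_locales (auto simp: m_assoc deg_mult deg_zero)
qed

section \<open>Recovering right divisibility from left divisibility\<close>

locale graded_cancel_monoid = graded_monoid M deg + monoid_cancel M
  for M :: "'m monoid" (structure) and deg :: "'m \<Rightarrow> nat"
begin

sublocale op: graded_monoid "opposite M" deg
  by (rule graded_monoid_opposite) unfold_locales

text \<open>
  Passing to complements inside a common left multiple \<open>m = p a = q b\<close> reverses divisibility: if
  \<open>m = l d\<close>, where \<open>l\<close> is the right lcm of \<open>p\<close> and \<open>q\<close>, then \<open>d\<close> is the right gcd of \<open>a\<close> and \<open>b\<close>.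
\<close>

lemma right_gcd_if_right_lcm:
  assumes ab: "a \<in> carrier M" "b \<in> carrier M"
    and lcm: "\<And>a b. a \<in> carrier M \<Longrightarrow> b \<in> carrier M \<Longrightarrow> \<exists>m\<in>carrier M. m lcmof a b"
    and m: "m \<in> carrier M" "a divides\<^bsub>opposite M\<^esub> m" "b divides\<^bsub>opposite M\<^esub> m"
  shows "\<exists>d\<in>carrier M. d gcdof\<^bsub>opposite M\<^esub> a b"
proof -
  obtain p q where p: "p \<in> carrier M" "m = p \<otimes> a" and q: "q \<in> carrier M" "m = q \<otimes> b"
    using m by (auto simp: factor_def)
  obtain l where l: "l \<in> carrier M" "l lcmof p q" using lcm p q by blast
  have "p divides m" "q divides m" using p q ab unfolding factor_def by blast+
  then have "l divides m" using l m by (auto simp: islcm_def)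
  then obtain d where d: "d \<in> carrier M" "m = l \<otimes> d" by (auto simp: factor_def)
  obtain s t where s: "s \<in> carrier M" "l = p \<otimes> s" and t: "t \<in> carrier M" "l = q \<otimes> t"
    using l by (auto simp: islcm_def factor_def)
  have a: "a = s \<otimes> d" by (rule l_cancel[of p]) (use p s d ab in \<open>auto simp: m_assoc\<close>)
  have b: "b = t \<otimes> d" by (rule l_cancel[of q]) (use q t d ab in \<open>auto simp: m_assoc\<close>)
  have "e divides\<^bsub>opposite M\<^esub> d"
    if e: "e \<in> carrier M" "e divides\<^bsub>opposite M\<^esub> a" "e divides\<^bsub>opposite M\<^esub> b" for e
  proof -
    obtain s' t' where s': "s' \<in> carrier M" "a = s' \<otimes> e" and t': "t' \<in> carrier M" "b = t' \<otimes> e"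
      using e by (auto simp: factor_def)
    have "p \<otimes> s' = q \<otimes> t'"
      by (rule r_cancel[of _ e]) (use p q s' t' e in \<open>auto simp: m_assoc\<close>)
    then have "p divides p \<otimes> s'" "q divides p \<otimes> s'" using s' t' unfolding factor_def by blast+
    then have "l divides p \<otimes> s'" using l p s' by (auto simp: islcm_def)
    then obtain r where r: "r \<in> carrier M" "p \<otimes> s' = l \<otimes> r" by (auto simp: factor_def)
    have "l \<otimes> d = l \<otimes> (r \<otimes> e)"
      using p s' e d r l m_assoc[of p s' e] m_assoc[of l r e] by simp
    then have "d = r \<otimes> e" using l_cancel l d r e by blast
    then show ?thesis using r by (auto simp: factor_def)
  qed
  then show ?thesis using a b d s t by (auto simp: isgcd_def factor_def)
qed

text \<open>
  Only one inclusion between the two sets of divisors is required, as it is the one that can be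
  read off coordinates; finiteness gives the other.
\<close>

definition balanced :: "'m \<Rightarrow> bool"
  where "balanced d \<longleftrightarrow> d \<in> carrier M \<and> finite {x \<in> carrier M. x divides d} \<and>
    {x \<in> carrier M. x divides\<^bsub>opposite M\<^esub> d} \<subseteq> {x \<in> carrier M. x divides d}"

text \<open>
  Taking complements injects the left divisors into the right divisors.
\<close>

lemma balanced_divisors:
  assumes "balanced d"
  shows "{x \<in> carrier M. x divides\<^bsub>opposite M\<^esub> d} = {x \<in> carrier M. x divides d}"
    (is "?R = ?L")
proof -
  have d: "d \<in> carrier M" "finite ?L" "?R \<subseteq> ?L" using assms by (auto simp: balanced_def)
  define comp where "comp a = (SOME b. b \<in> carrier M \<and> d = a \<otimes> b)" for a
  have comp: "comp a \<in> carrier M \<and> d = a \<otimes> comp a" if "a \<in> ?L" for a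
    unfolding comp_def by (rule someI_ex) (use that in \<open>unfold factor_def, blast\<close>)
  have "inj_on comp ?L"
  proof (rule inj_onI)
    fix a b assume ab: "a \<in> ?L" "b \<in> ?L" "comp a = comp b"
    then have "a \<otimes> comp a = b \<otimes> comp a" using comp[OF ab(1)] comp[OF ab(2)] by metis
    then show "a = b" using ab comp[OF ab(1)] r_cancel by blast
  qed
  moreover have "comp ` ?L \<subseteq> ?R" using comp by (fastforce simp: factor_def)
  ultimately have "card ?L \<le> card ?R"
    using card_inj_on_le finite_subset[OF d(3,2)] by blast
  then show ?thesis using d card_seteq by blast
qed

lemma garside_if_left_gcd_and_balanced:
  assumes gcd: "\<And>a b. a \<in> carrier M \<Longrightarrow> b \<in> carrier M \<Longrightarrow> \<exists>d\<in>carrier M. d gcdof a b"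
    and bal: "\<And>a b. a \<in> carrier M \<Longrightarrow> b \<in> carrier M
      \<Longrightarrow> \<exists>d. balanced d \<and> a divides d \<and> b divides d"
    and gen: "balanced d" "generates M {x \<in> carrier M. x divides d}"
  shows "garside_monoid M"
proof -
  have lcm: "\<exists>m\<in>carrier M. m lcmof a b" if "a \<in> carrier M" "b \<in> carrier M" for a b
    using lcm_if_gcd[OF gcd] bal[OF that] that by (auto simp: balanced_def)
  have com: "\<exists>m\<in>carrier M. a divides\<^bsub>opposite M\<^esub> m \<and> b divides\<^bsub>opposite M\<^esub> m"
    if ab: "a \<in> carrier M" "b \<in> carrier M" for a b
  proof -
    obtain d where d: "balanced d" "a divides d" "b divides d" using bal[OF ab] by blast
    then have "a divides\<^bsub>opposite M\<^esub> d" "b divides\<^bsub>opposite M\<^esub> d"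
      using balanced_divisors[OF d(1)] ab by blast+
    then show ?thesis using d by (auto simp: balanced_def)
  qed
  have rgcd: "\<exists>m\<in>carrier M. m gcdof\<^bsub>opposite M\<^esub> a b" if "a \<in> carrier M" "b \<in> carrier M" for a b
    using right_gcd_if_right_lcm[OF that lcm] com[OF that] by blast
  have llcm: "\<exists>m\<in>carrier M. m lcmof\<^bsub>opposite M\<^esub> a b" if ab: "a \<in> carrier M" "b \<in> carrier M" for a b
  proof -
    obtain m where "m \<in> carrier M" "a divides\<^bsub>opposite M\<^esub> m" "b divides\<^bsub>opposite M\<^esub> m"
      using com[OF ab] by blast
    then show ?thesis using op.lcm_if_gcd[of a b m] rgcd ab by simp
  qed
  have "gaussian_monoid M"
    unfolding gaussian_monoid_def left_gcd_def right_gcd_def left_lcm_def right_lcm_def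
    by (intro conjI ballI atomic monoid_cancel_axioms gcd rgcd lcm llcm)
  moreover have "garside_element M d"
    using gen balanced_divisors[OF gen(1)]
    by (auto simp: garside_element_def left_divisor_def right_divisor_def balanced_def)
  ultimately show ?thesis unfolding garside_monoid_def by blast
qed

end

section \<open>Involutive non-degenerate solutions\<close>

locale involutive_solution =
  fixes X :: "'a set" and S :: "'a \<times> 'a \<Rightarrow> 'a \<times> 'a"
  assumes solution: "set_solution X S"
    and non_deg: "non_degenerate X S"
    and invol: "involutive X S"
begin

lemma S_closed: "x \<in> X \<Longrightarrow> y \<in> X \<Longrightarrow> fst (S (x, y)) \<in> X \<and> snd (S (x, y)) \<in> X"
proof -
  assume "x \<in> X" "y \<in> X"
  then have "S (x, y) \<in> X \<times> X"
    using solution bij_betwE[of S "X \<times> X" "X \<times> X"] by (auto simp: set_solution_def)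
  then show ?thesis by (auto simp: mem_Times_iff)
qed

lemma S_swap: "x \<in> X \<Longrightarrow> y \<in> X \<Longrightarrow> S (x, y) = (t, z) \<Longrightarrow> S (t, z) = (x, y)"
  using invol unfolding involutive_def by (metis SigmaI)

text \<open>
  The maps \<open>\<sigma>\<^sub>x\<close>, extended by the identity outside \<open>X\<close> so that they are bijections of the whole type.
\<close>

definition perm :: "'a \<Rightarrow> 'a \<Rightarrow> 'a"
  where "perm x p = (if p \<in> X then fst (S (x, p)) else p)"

lemma perm_in_iff: "x \<in> X \<Longrightarrow> perm x p \<in> X \<longleftrightarrow> p \<in> X"
  using S_closed by (auto simp: perm_def)

lemma bij_betw_perm: "x \<in> X \<Longrightarrow> bij_betw (perm x) X X"
  using non_deg unfolding non_degenerate_def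
  by (metis (no_types, lifting) bij_betw_cong perm_def)

lemma bij_perm: "x \<in> X \<Longrightarrow> bij (perm x)"
proof -
  assume x: "x \<in> X"
  have "bij_betw (perm x) (- X) (- X)"
    by (auto simp: bij_betw_def inj_on_def perm_def image_def)
  then have "bij_betw (perm x) (X \<union> - X) (X \<union> - X)"
    using bij_betw_perm[OF x] by (intro bij_betw_combine) auto
  then show ?thesis by simp
qed

lemma perm_inj: "x \<in> X \<Longrightarrow> perm x p = perm x q \<longleftrightarrow> p = q"
  using bij_is_inj[OF bij_perm] by (auto simp: inj_eq)

lemma perm_S:
  assumes "x \<in> X" "y \<in> X" "S (x, y) = (t, z)"
  shows "t \<in> X" "z \<in> X" "perm x y = t" "perm t z = x"
  using S_closed[OF assms(1,2)] S_swap[OF assms] assms by (auto simp: perm_def)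

definition perm_law :: bool
  where "perm_law \<longleftrightarrow> (\<forall>x\<in>X. \<forall>y\<in>X. \<forall>t z. S (x, y) = (t, z)
    \<longrightarrow> perm x \<circ> perm y = perm t \<circ> perm z)"

lemma perm_law_comp:
  assumes "perm_law" "x \<in> X" "y \<in> X" "S (x, y) = (t, z)"
  shows "perm x (perm y p) = perm t (perm z p)"
proof -
  have "perm x \<circ> perm y = perm t \<circ> perm z" using assms unfolding perm_law_def by blast
  then show ?thesis by (metis comp_apply)
qed

text \<open>
  The law is the first component of the braid equation.
\<close>

lemma perm_law_if_braided:
  assumes "braided X S"
  shows "perm_law"
  unfolding perm_law_def
proof (intro ballI allI impI ext)
  fix x y t z p assume xy: "x \<in> X" "y \<in> X" and S: "S (x, y) = (t, z)"
  note tz = perm_S[OF xy S]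
  show "(perm x \<circ> perm y) p = (perm t \<circ> perm z) p"
  proof (cases "p \<in> X")
    case True
    then have "(S12 S \<circ> S23 S \<circ> S12 S) (x, y, p) = (S23 S \<circ> S12 S \<circ> S23 S) (x, y, p)"
      using assms xy unfolding braided_def by blast
    then have "fst (S (t, fst (S (z, p)))) = fst (S (x, fst (S (y, p))))"
      by (auto simp: S12_def S23_def S split: prod.splits)
    then show ?thesis
      using True xy tz S_closed by (simp add: perm_def)
  qed (simp add: perm_def)
qed

text \<open>
  The law determines the other two components as well.  If \<open>S(x, y) = (t, z)\<close>, then \<open>\<sigma>\<^sub>t(z) = x\<close>, as
  \<open>S\<close> is an involution; so for both sides \<open>(p, q, r)\<close> of the braid equation at \<open>(x, y, z')\<close> the
  value \<open>\<sigma>\<^sub>p(q)\<close> is \<open>t\<close> and \<open>\<sigma>\<^sub>p \<sigma>\<^sub>q (r)\<close> is \<open>x\<close>.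
\<close>

lemma braided_if_perm_law:
  assumes law: "perm_law"
  shows "braided X S"
  unfolding braided_def
proof
  fix xyz assume "xyz \<in> X \<times> X \<times> X"
  then obtain x y z where xyz: "xyz = (x, y, z)" "x \<in> X" "y \<in> X" "z \<in> X" by auto
  obtain t u where tu: "S (x, y) = (t, u)" by force
  note tu' = perm_S[OF xyz(2,3) tu]
  obtain m r where mr: "S (u, z) = (m, r)" by force
  note mr' = perm_S[OF tu'(2) xyz(4) mr]
  obtain p q where pq: "S (t, m) = (p, q)" by force
  note pq' = perm_S[OF tu'(1) mr'(1) pq]
  obtain v w where vw: "S (y, z) = (v, w)" by force
  note vw' = perm_S[OF xyz(3,4) vw]
  obtain p' s where ps: "S (x, v) = (p', s)" by force
  note ps' = perm_S[OF xyz(2) vw'(1) ps]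
  obtain q' r' where qr: "S (s, w) = (q', r')" by force
  note qr' = perm_S[OF ps'(2) vw'(2) qr]
  note comp = perm_law_comp[OF law]
  have p: "p = p'"
    using comp[OF xyz(2,3) tu, of z] pq' mr' vw' ps' by simp
  have "perm p q = perm p q'"
    using comp[OF xyz(2) vw'(1) ps, of w] pq' qr' vw' tu' by (simp add: p)
  then have q: "q = q'" using perm_inj pq' by blast
  have "perm p (perm q r) = perm p (perm q r')"
    using comp[OF tu'(1) mr'(1) pq, of r] mr' tu' qr' ps' by (simp add: p q)
  then have r: "r = r'" using perm_inj pq' by blast
  show "(S12 S \<circ> S23 S \<circ> S12 S) xyz = (S23 S \<circ> S12 S \<circ> S23 S) xyz"
    using p q r by (simp add: S12_def S23_def xyz tu mr pq vw ps qr)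
qed

end

section \<open>The affine action of the structure group\<close>

locale braided_solution = involutive_solution X S for X :: "'a set" and S +
  assumes fin: "finite X" and braided: "braided X S"
begin

lemma perm_comp:
  "x \<in> X \<Longrightarrow> y \<in> X \<Longrightarrow> S (x, y) = (t, z) \<Longrightarrow> perm x (perm y p) = perm t (perm z p)"
  by (rule perm_law_comp[OF perm_law_if_braided[OF braided]])

text \<open>
  The affine map \<open>f \<mapsto> e\<^sub>x + \<sigma>\<^sub>x \<cdot> f\<close> by which a letter acts, and its inverse.
\<close>

definition shift :: "'a \<Rightarrow> ('a \<Rightarrow> int) \<Rightarrow> 'a \<Rightarrow> int"
  where "shift x f = (\<lambda>p. f (inv_into UNIV (perm x) p) + of_bool (p = x))"

definition unshift :: "'a \<Rightarrow> ('a \<Rightarrow> int) \<Rightarrow> 'a \<Rightarrow> int"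
  where "unshift x f = (\<lambda>p. f (perm x p) - of_bool (perm x p = x))"

definition orthant :: "('a \<Rightarrow> int) set"
  where "orthant = {f. (\<forall>p. 0 \<le> f p) \<and> (\<forall>p. p \<notin> X \<longrightarrow> f p = 0)}"

lemma shift_perm: "x \<in> X \<Longrightarrow> shift x f (perm x p) = f p + of_bool (perm x p = x)"
  by (simp add: shift_def inv_f_f[OF bij_is_inj[OF bij_perm]])

lemma unshift_shift: "x \<in> X \<Longrightarrow> unshift x (shift x f) = f"
  by (simp add: unshift_def shift_perm fun_eq_iff)

lemma shift_unshift: "x \<in> X \<Longrightarrow> shift x (unshift x f) = f"
  by (simp add: unshift_def shift_def fun_eq_iff surj_f_inv_f[OF bij_is_surj[OF bij_perm]])

lemma perm_ext:
  assumes "x \<in> X" "\<And>p. f (perm x p) = g (perm x p)"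
  shows "f = g"
  using assms(2) surjD[OF bij_is_surj[OF bij_perm[OF assms(1)]]] by (metis ext)

lemma shift_mono: "f \<le> g \<Longrightarrow> shift x f \<le> shift x g"
  by (simp add: shift_def le_fun_def)

lemma unshift_mono: "f \<le> g \<Longrightarrow> unshift x f \<le> unshift x g"
  by (simp add: unshift_def le_fun_def)

lemma zero_orthant: "(\<lambda>_. 0) \<in> orthant"
  by (simp add: orthant_def)

lemma shift_orthant:
  assumes x: "x \<in> X" and f: "f \<in> orthant"
  shows "shift x f \<in> orthant"
proof -
  have "inv_into UNIV (perm x) p \<notin> X" if "p \<notin> X" for p
    using that perm_in_iff[OF x, of "inv_into UNIV (perm x) p"]
    by (simp add: surj_f_inv_f[OF bij_is_surj[OF bij_perm[OF x]]])
  then show ?thesis using x f by (auto simp: shift_def orthant_def)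
qed

lemma unshift_supported:
  assumes "x \<in> X" "p \<notin> X" "\<And>p. p \<notin> X \<Longrightarrow> f p = 0"
  shows "unshift x f p = 0"
proof -
  have "perm x p \<notin> X" using perm_in_iff[OF assms(1)] assms(2) by blast
  then show ?thesis using assms(1,3) by (auto simp: unshift_def)
qed

lemma unshift_orthant:
  assumes "x \<in> X" "f \<in> orthant" "0 < f x"
  shows "unshift x f \<in> orthant"
proof -
  have "0 \<le> unshift x f p" for p using assms by (auto simp: unshift_def orthant_def of_bool_def)
  moreover have "unshift x f p = 0" if "p \<notin> X" for p
    using unshift_supported[OF assms(1) that, of f] assms(2) by (simp add: orthant_def)
  ultimately show ?thesis by (simp add: orthant_def)
qed

lemma sum_shift:
  assumes "x \<in> X"
  shows "(\<Sum>p\<in>X. shift x f p) = (\<Sum>p\<in>X. f p) + 1"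
proof -
  have "(\<Sum>p\<in>X. shift x f p) = (\<Sum>p\<in>X. shift x f (perm x p))"
    by (rule sum.reindex_bij_betw[OF bij_betw_perm[OF assms], symmetric])
  also have "\<dots> = (\<Sum>p\<in>X. f p) + (\<Sum>p\<in>X. of_bool (perm x p = x))"
    by (simp add: shift_perm assms sum.distrib)
  also have "(\<Sum>p\<in>X. of_bool (perm x p = x)) = (\<Sum>p\<in>X. of_bool (p = x) :: int)"
    by (rule sum.reindex_bij_betw[OF bij_betw_perm[OF assms]])
  also have "\<dots> = 1" using fin assms by (simp add: of_bool_def)
  finally show ?thesis .
qed

text \<open>
  The action respects the defining relations.  The linear parts agree by \<open>perm_comp\<close>, and the
  translation part is \<open>e\<^sub>x + e\<^sub>t\<close> on both sides, as \<open>t = \<sigma>\<^sub>x(y)\<close> and \<open>x = \<sigma>\<^sub>t(z)\<close>.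
\<close>

lemma shift_comp:
  assumes xy: "x \<in> X" "y \<in> X" and S: "S (x, y) = (t, z)"
  shows "shift x (shift y f) = shift t (shift z f)"
proof -
  note tz = perm_S[OF xy S]
  have "shift x (shift y f) (perm x (perm y p)) = shift t (shift z f) (perm x (perm y p))" for p
  proof -
    have "shift x (shift y f) (perm x (perm y p))
        = f p + of_bool (perm x (perm y p) = t) + of_bool (perm x (perm y p) = x)"
      using xy tz perm_inj[OF xy(1), of "perm y p" y] by (simp add: shift_perm)
    moreover have "shift t (shift z f) (perm t (perm z p))
        = f p + of_bool (perm t (perm z p) = x) + of_bool (perm t (perm z p) = t)"
      using xy tz perm_inj[OF tz(1), of "perm z p" z] by (simp add: shift_perm)
    ultimately show ?thesis by (simp add: perm_comp[OF xy S])
  qed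
  then have "shift x (shift y f) (perm x q) = shift t (shift z f) (perm x q)" for q
    using surjD[OF bij_is_surj[OF bij_perm[OF xy(2)]]] by metis
  then show ?thesis using perm_ext[OF xy(1)] by blast
qed

definition coords :: "'a list \<Rightarrow> 'a \<Rightarrow> int"
  where "coords u = foldr shift u (\<lambda>_. 0)"

lemma coords_simps [simp]: "coords [] = (\<lambda>_. 0)" "coords (x # u) = shift x (coords u)"
  by (simp_all add: coords_def)

lemma coords_append: "coords (u @ v) = foldr shift u (coords v)"
  by (simp add: coords_def)

lemma foldr_shift_mono: "f \<le> g \<Longrightarrow> foldr shift u f \<le> foldr shift u g"
  by (induction u) (auto intro: shift_mono)

lemma coords_orthant: "u \<in> lists X \<Longrightarrow> coords u \<in> orthant"
  by (induction u) (auto intro: zero_orthant shift_orthant)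

lemma sum_coords: "u \<in> lists X \<Longrightarrow> (\<Sum>p\<in>X. coords u p) = int (length u)"
  by (induction u) (auto simp: sum_shift)

lemma coords_le_length: "u \<in> lists X \<Longrightarrow> coords u p \<le> int (length u)"
proof (cases "p \<in> X")
  case True
  assume u: "u \<in> lists X"
  have "coords u p \<le> (\<Sum>p\<in>X. coords u p)"
    using coords_orthant[OF u] fin True by (intro member_le_sum) (auto simp: orthant_def)
  then show ?thesis using sum_coords[OF u] by simp
next
  case False
  assume "u \<in> lists X"
  then show ?thesis using coords_orthant[of u] False by (auto simp: orthant_def)
qed

text \<open>
  Any letter \<open>x\<close> with \<open>f x > 0\<close> can be split off from the left.
\<close>

lemma coords_surj:
  assumes "f \<in> orthant"
  shows "\<exists>u\<in>lists X. coords u = f"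
  using assms
proof (induction "nat (\<Sum>p\<in>X. f p)" arbitrary: f)
  case 0
  have nonneg: "0 \<le> f p" for p using 0 by (simp add: orthant_def)
  then have "(\<Sum>p\<in>X. f p) = 0" using 0 by (simp add: sum_nonneg order_antisym)
  then have "f p = 0" if "p \<in> X" for p
    using that sum_nonneg_eq_0_iff[OF fin, of f] nonneg by auto
  then have "f = (\<lambda>_. 0)" using 0 by (auto simp: orthant_def)
  then show ?case by (intro bexI[of _ "[]"]) auto
next
  case (Suc n)
  have nonneg: "0 \<le> f p" for p using Suc.prems by (simp add: orthant_def)
  obtain x where x: "x \<in> X" "0 < f x"
  proof (rule ccontr)
    assume "\<not> thesis"
    then have "(\<Sum>p\<in>X. f p) = 0" using that nonneg by (intro sum.neutral) (meson antisym not_less)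
    then show False using Suc.hyps(2) by simp
  qed
  have "(\<Sum>p\<in>X. f p) = (\<Sum>p\<in>X. unshift x f p) + 1"
    using sum_shift[OF x(1), of "unshift x f"] shift_unshift[OF x(1)] by simp
  then have "n = nat (\<Sum>p\<in>X. unshift x f p)" using Suc.hyps(2) by simp
  then obtain u where "u \<in> lists X" "coords u = unshift x f"
    using Suc.hyps(1) unshift_orthant[OF x(1) Suc.prems x(2)] by blast
  then show ?case using x shift_unshift by (intro bexI[of _ "x # u"]) auto
qed

text \<open>
  The action of \<open>u\<close> is an automorphism of the componentwise order, so undoing it moves every
  point of the orthant above \<open>coords u\<close> back into the orthant.
\<close>

lemma coords_quotient:
  assumes "u \<in> lists X" "g \<in> orthant" "coords u \<le> g"
  shows "\<exists>v\<in>lists X. coords (u @ v) = g"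
proof -
  have ex: "\<exists>h. (\<forall>p. p \<notin> X \<longrightarrow> h p = 0) \<and> (\<lambda>_. 0) \<le> h \<and> foldr shift u h = g"
    if "\<And>p. p \<notin> X \<Longrightarrow> g p = 0" "coords u \<le> g" for g
    using assms(1) that
  proof (induction u arbitrary: g rule: list.induct)
    case Nil
    then show ?case by auto
  next
    case (Cons x u)
    have x: "x \<in> X" using Cons.prems by simp
    have "coords u \<le> unshift x g"
      using unshift_mono[OF Cons.prems(3), of x] unshift_shift[OF x] by simp
    moreover have "unshift x g p = 0" if "p \<notin> X" for p
      using unshift_supported[OF x that Cons.prems(2)] .
    ultimately obtain h where
      "\<forall>p. p \<notin> X \<longrightarrow> h p = 0" "(\<lambda>_. 0) \<le> h" "foldr shift u h = unshift x g"
      using Cons.IH[of "unshift x g"] Cons.prems(1) by auto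
    then show ?case using shift_unshift[OF x] by (intro exI[of _ h]) auto
  qed
  have "\<And>p. p \<notin> X \<Longrightarrow> g p = 0" using assms(2) by (simp add: orthant_def)
  from ex[OF this assms(3)] obtain h
    where h: "\<forall>p. p \<notin> X \<longrightarrow> h p = 0" "(\<lambda>_. 0) \<le> h" "foldr shift u h = g"
    by blast
  then have "h \<in> orthant" by (simp add: orthant_def le_fun_def)
  then show ?thesis using coords_surj h by (metis coords_append)
qed

text \<open>
  The action permutes entries and increases some of them.  This is why a constant vector bounds the
  coordinates of its right divisors too.
\<close>

lemma foldr_shift_dominates:
  assumes "u \<in> lists X" "p \<in> X"
  shows "\<exists>q\<in>X. f p \<le> foldr shift u f q"
  using assms(1)
proof (induction u rule: list.induct)
  case (Cons x u)
  then obtain q where q: "q \<in> X" "f p \<le> foldr shift u f q" by auto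
  then show ?case
    using Cons.prems perm_in_iff[of x q] shift_perm[of x "foldr shift u f" q]
    by (intro bexI[of _ "perm x q"]) auto
qed (use assms in auto)

lemma length_eq_if_coords_eq:
  "u \<in> lists X \<Longrightarrow> v \<in> lists X \<Longrightarrow> coords u = coords v \<Longrightarrow> length u = length v"
  by (metis sum_coords of_nat_eq_iff)

text \<open>
  Let two words with the same coordinates begin with distinct letters \<open>x\<close> and \<open>y\<close>.  The \<open>y\<close>-coordinate
  is positive, so the first word can be rewritten to begin with \<open>x a\<close>, where \<open>\<sigma>\<^sub>x(a) = y\<close>; the
  relation \<open>x a = y b\<close> then makes the first letters equal.
\<close>

lemma word_cong_if_coords_eq:
  assumes "u \<in> lists X" "v \<in> lists X" "coords u = coords v"
  shows "(u, v) \<in> word_cong X (structure_relations X S)"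
  using assms
proof (induction "length u" arbitrary: u v)
  case 0
  then have "u = []" "v = []" using length_eq_if_coords_eq[OF 0(2-4)] by auto
  then show ?case by (auto intro: word_cong.refl)
next
  case (Suc n)
  let ?W = "word_cong X (structure_relations X S)"
  have len: "length v = Suc n" using length_eq_if_coords_eq[OF Suc.prems] Suc.hyps(2) by simp
  obtain x u' where u: "u = x # u'" "x \<in> X" "u' \<in> lists X" "length u' = n"
    using Suc.hyps(2) Suc.prems(1) by (cases u) auto
  obtain y v' where v: "v = y # v'" "y \<in> X" "v' \<in> lists X" "length v' = n"
    using len Suc.prems(2) by (cases v) auto
  have eq: "shift x (coords u') = shift y (coords v')" using Suc.prems(3) u v by simp
  have prefix: "(w @ s, w @ s') \<in> ?W" if "w \<in> lists X" "(s, s') \<in> ?W" for w s s'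
    using that by (intro word_cong.append word_cong.refl)
  show ?case
  proof (cases "x = y")
    case True
    then have "coords u' = coords v'" using eq unshift_shift u by metis
    then have "(u', v') \<in> ?W" using Suc.hyps(1) u v by blast
    then show ?thesis using prefix[of "[x]"] u v True by simp
  next
    case False
    obtain a where a: "a \<in> X" "perm x a = y"
      using bij_betw_perm[OF u(2)] v(2) by (metis bij_betw_imp_surj_on imageE)
    obtain b where S: "S (x, a) = (y, b)" using a by (metis perm_def prod.collapse)
    note b = perm_S[OF u(2) a(1) S]
    have "0 \<le> coords v' (inv_into UNIV (perm y) y)" using coords_orthant[OF v(3)] by (simp add: orthant_def)
    then have "0 < shift y (coords v') y" by (simp add: shift_def)
    then have "0 < coords u' a"
      using shift_perm[OF u(2), of "coords u'" a] a False eq by simp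
    then have "unshift a (coords u') \<in> orthant"
      using unshift_orthant[OF a(1) coords_orthant[OF u(3)]] by blast
    then obtain w where w: "w \<in> lists X" "coords w = unshift a (coords u')"
      using coords_surj by blast
    have aw: "coords (a # w) = coords u'" using w shift_unshift[OF a(1)] by simp
    then have "(u', a # w) \<in> ?W" using Suc.hyps(1) u w a by simp
    then have 1: "(u, [x, a] @ w) \<in> ?W" using prefix[of "[x]"] u by simp
    have "([x, a], [y, b]) \<in> ?W"
      using S u a v b by (intro word_cong.rel) (auto simp: structure_relations_def)
    then have 2: "([x, a] @ w, [y, b] @ w) \<in> ?W"
      using w by (intro word_cong.append word_cong.refl)
    have "shift y (coords v') = shift y (coords (b # w))"
      using eq aw shift_comp[OF u(2) a(1) S, of "coords w"] by simp
    then have "coords v' = coords (b # w)" using unshift_shift[OF v(2)] by metis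
    then have "(v', b # w) \<in> ?W" using Suc.hyps(1) v w b by simp
    then have "(v, [y, b] @ w) \<in> ?W" using prefix[of "[y]"] v by simp
    then show ?thesis using 1 2 by (blast intro: word_cong.sym word_cong.trans)
  qed
qed

end

section \<open>The structure group is a Garside group\<close>

lemma word_cong_group_relations:
  assumes "(u, v) \<in> word_cong X R"
  shows "(map (\<lambda>x. (x, True)) u, map (\<lambda>x. (x, True)) v)
    \<in> word_cong (X \<times> UNIV) (group_relations X R)"
  using assms
proof (induction rule: word_cong.induct)
  case (rel u v)
  then show ?case
    by (intro word_cong.rel) (auto simp: group_relations_def)
next
  case (refl u)
  then show ?case by (intro word_cong.refl) auto
next
  case (append u v u' v')
  then show ?case using word_cong.append by fastforce
qed (blast intro: word_cong.sym word_cong.trans)+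

context braided_solution
begin

definition act :: "('a \<times> bool) list \<Rightarrow> ('a \<Rightarrow> int) \<Rightarrow> 'a \<Rightarrow> int"
  where "act = foldr (\<lambda>(x, e). if e then shift x else unshift x)"

lemma act_append: "act (u @ v) = act u \<circ> act v"
  by (simp add: act_def fun_eq_iff)

lemma act_positive: "act (map (\<lambda>x. (x, True)) u) = foldr shift u"
  by (induction u) (simp_all add: act_def)

text \<open>
  The action is well defined on the group, so positive words that agree in the group have equal
  coordinates: the presented monoid embeds.
\<close>

lemma act_cong:
  assumes "(u, v) \<in> word_cong (X \<times> UNIV) (group_relations X (structure_relations X S))"
  shows "act u = act v"
  using assms
proof (induction rule: word_cong.induct)
  case (rel u v)
  consider x y t z where "x \<in> X" "y \<in> X" "S (x, y) = (t, z)"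
      "u = map (\<lambda>x. (x, True)) [x, y]" "v = map (\<lambda>x. (x, True)) [t, z]"
    | x e where "x \<in> X" "u = [(x, e), (x, \<not> e)]" "v = []"
    using rel(1) by (auto simp: group_relations_def structure_relations_def)
  then show ?case
  proof cases
    case 1
    then show ?thesis using shift_comp by (simp only: act_positive) (simp add: fun_eq_iff)
  next
    case 2
    then show ?thesis
      by (cases e) (simp_all add: act_def fun_eq_iff shift_unshift unshift_shift)
  qed
qed (simp_all add: act_append)

abbreviation G :: "('a \<times> bool) list set monoid"
  where "G \<equiv> structure_group X S"

abbreviation "group_cong \<equiv> word_cong (X \<times> UNIV) (group_relations X (structure_relations X S))"

definition pos :: "'a list \<Rightarrow> ('a \<times> bool) list set"
  where "pos u = group_cong `` {map (\<lambda>x. (x, True)) u}"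

text \<open>
  The monoid is taken inside the group.  By \<open>pos_eq_iff\<close> and
  \<open>word_cong_if_coords_eq\<close> it is isomorphic to the monoid with the same
  presentation.
\<close>

definition positive_monoid :: "('a \<times> bool) list set monoid"
  where "positive_monoid = G\<lparr>carrier := pos ` lists X\<rparr>"

interpretation G: group G
  unfolding structure_group_def by (rule group_presented_group)

lemma G_carrier: "carrier G = {group_cong `` {w} | w. w \<in> lists (X \<times> UNIV)}"
  by (simp add: structure_group_def presented_group_def presented_monoid_carrier)

lemma G_mult:
  "v \<in> lists (X \<times> UNIV) \<Longrightarrow> w \<in> lists (X \<times> UNIV)
    \<Longrightarrow> group_cong `` {v} \<otimes>\<^bsub>G\<^esub> group_cong `` {w} = group_cong `` {v @ w}"
  by (simp add: structure_group_def presented_group_def presented_monoid_mult)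

lemma G_one: "\<one>\<^bsub>G\<^esub> = group_cong `` {[]}"
  by (simp add: structure_group_def presented_group_def presented_monoid_def)

lemma positive_word: "u \<in> lists X \<Longrightarrow> map (\<lambda>x. (x, e)) u \<in> lists (X \<times> UNIV)"
  by auto

lemma class_closed: "w \<in> lists (X \<times> UNIV) \<Longrightarrow> group_cong `` {w} \<in> carrier G"
  unfolding G_carrier by (rule CollectI, rule exI, rule conjI, rule HOL.refl)

lemma pos_closed: "u \<in> lists X \<Longrightarrow> pos u \<in> carrier G"
  unfolding pos_def by (intro class_closed positive_word)

lemma pos_append: "u \<in> lists X \<Longrightarrow> v \<in> lists X \<Longrightarrow> pos u \<otimes>\<^bsub>G\<^esub> pos v = pos (u @ v)"
  unfolding pos_def by (simp only: G_mult positive_word map_append)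

lemma pos_Nil: "pos [] = \<one>\<^bsub>G\<^esub>"
  by (simp add: pos_def G_one)

lemma pos_eq_iff:
  assumes "u \<in> lists X" "v \<in> lists X"
  shows "pos u = pos v \<longleftrightarrow> coords u = coords v"
proof
  assume "pos u = pos v"
  then have "(map (\<lambda>x. (x, True)) u, map (\<lambda>x. (x, True)) v) \<in> group_cong"
    unfolding pos_def by (rule eq_equiv_class[OF _ equiv_word_cong positive_word[OF assms(2)]])
  then have "foldr shift u = foldr shift v" using act_cong act_positive by metis
  then show "coords u = coords v" by (simp add: coords_def)
next
  assume "coords u = coords v"
  then show "pos u = pos v"
    unfolding pos_def using assms
    by (intro equiv_class_eq[OF equiv_word_cong] word_cong_group_relations word_cong_if_coords_eq)
qed

lemma positive_simps [simp]:
  "carrier positive_monoid = pos ` lists X"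
  "a \<otimes>\<^bsub>positive_monoid\<^esub> b = a \<otimes>\<^bsub>G\<^esub> b"
  "\<one>\<^bsub>positive_monoid\<^esub> = \<one>\<^bsub>G\<^esub>"
  by (simp_all add: positive_monoid_def)

definition deg :: "('a \<times> bool) list set \<Rightarrow> nat"
  where "deg a = length (SOME u. u \<in> lists X \<and> pos u = a)"

lemma deg_pos: "u \<in> lists X \<Longrightarrow> deg (pos u) = length u"
proof -
  assume u: "u \<in> lists X"
  define v where "v = (SOME v. v \<in> lists X \<and> pos v = pos u)"
  have "v \<in> lists X \<and> pos v = pos u" unfolding v_def by (rule someI[of _ u]) (use u in simp)
  then have "length v = length u" using u pos_eq_iff length_eq_if_coords_eq by blast
  then show ?thesis by (simp add: deg_def v_def)
qed

interpretation P: graded_cancel_monoid positive_monoid deg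
proof -
  have sub: "pos ` lists X \<subseteq> carrier G" using pos_closed by blast
  have closed: "a \<otimes>\<^bsub>G\<^esub> b \<in> pos ` lists X" if "a \<in> pos ` lists X" "b \<in> pos ` lists X" for a b
  proof -
    obtain u v where "u \<in> lists X" "v \<in> lists X" "a = pos u" "b = pos v" using \<open>a \<in> _\<close> \<open>b \<in> _\<close> by blast
    then show ?thesis using pos_append[of u v] by (metis append_in_lists_conv imageI)
  qed
  have one: "\<one>\<^bsub>G\<^esub> \<in> pos ` lists X" using pos_Nil by (metis imageI lists.Nil)
  interpret submonoid "pos ` lists X" G
    using sub closed one by unfold_locales
  interpret monoid positive_monoid
    unfolding positive_monoid_def by (rule submonoid_is_monoid) unfold_locales
  show "graded_cancel_monoid positive_monoid deg"
  proof unfold_locales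
    fix a b assume "a \<in> carrier positive_monoid" "b \<in> carrier positive_monoid"
    then obtain u v where "u \<in> lists X" "v \<in> lists X" "a = pos u" "b = pos v" by auto
    then show "deg (a \<otimes>\<^bsub>positive_monoid\<^esub> b) = deg a + deg b" by (simp add: pos_append deg_pos)
  next
    fix a assume "a \<in> carrier positive_monoid" "deg a = 0"
    then obtain u where "u \<in> lists X" "a = pos u" "deg (pos u) = 0" by auto
    then show "a = \<one>\<^bsub>positive_monoid\<^esub>" by (simp add: deg_pos pos_Nil)
  next
    fix a b c
    assume *: "c \<otimes>\<^bsub>positive_monoid\<^esub> a = c \<otimes>\<^bsub>positive_monoid\<^esub> b" "a \<in> carrier positive_monoid"
      "b \<in> carrier positive_monoid" "c \<in> carrier positive_monoid"
    then have "a \<in> carrier G" "b \<in> carrier G" "c \<in> carrier G" using sub by (simp_all add: subset_iff)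
    then show "a = b" using *(1) by simp
  next
    fix a b c
    assume *: "a \<otimes>\<^bsub>positive_monoid\<^esub> c = b \<otimes>\<^bsub>positive_monoid\<^esub> c" "a \<in> carrier positive_monoid"
      "b \<in> carrier positive_monoid" "c \<in> carrier positive_monoid"
    then have "a \<in> carrier G" "b \<in> carrier G" "c \<in> carrier G" using sub by (simp_all add: subset_iff)
    then show "a = b" using *(1) by simp
  qed
qed

text \<open>
  The coordinates of \<open>u w\<close> arise from those of \<open>w\<close> by the action of \<open>u\<close>, which is monotone and sends
  \<open>0\<close> to \<open>coords u\<close>; \<open>coords_quotient\<close> is the converse.
\<close>

lemma divides_pos_iff:
  assumes "u \<in> lists X" "v \<in> lists X"
  shows "pos u divides\<^bsub>positive_monoid\<^esub> pos v \<longleftrightarrow> coords u \<le> coords v"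
proof
  assume "pos u divides\<^bsub>positive_monoid\<^esub> pos v"
  then obtain w where w: "w \<in> lists X" "pos v = pos u \<otimes>\<^bsub>G\<^esub> pos w"
    by (auto simp: factor_def)
  then have v: "coords v = foldr shift u (coords w)"
    using assms pos_append[of u w] pos_eq_iff[of v "u @ w"] by (simp add: coords_append)
  have "(\<lambda>_. 0) \<le> coords w" using coords_orthant[OF w(1)] by (simp add: orthant_def le_fun_def)
  then show "coords u \<le> coords v" unfolding v using foldr_shift_mono by (simp add: coords_def)
next
  assume "coords u \<le> coords v"
  then obtain w where w: "w \<in> lists X" "coords (u @ w) = coords v"
    using coords_quotient[OF assms(1) coords_orthant[OF assms(2)]] by blast
  then have "pos v = pos u \<otimes>\<^bsub>G\<^esub> pos w"
    using assms pos_append[of u w] pos_eq_iff[of v "u @ w"] by simp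
  then show "pos u divides\<^bsub>positive_monoid\<^esub> pos v" using w(1) by (auto simp: factor_def)
qed

lemma left_gcd_exists:
  assumes "a \<in> carrier positive_monoid" "b \<in> carrier positive_monoid"
  shows "\<exists>d\<in>carrier positive_monoid. d gcdof\<^bsub>positive_monoid\<^esub> a b"
proof -
  obtain u v where uv: "u \<in> lists X" "v \<in> lists X" "a = pos u" "b = pos v" using assms by auto
  have "(\<lambda>p. min (coords u p) (coords v p)) \<in> orthant"
    using coords_orthant[OF uv(1)] coords_orthant[OF uv(2)] by (auto simp: orthant_def)
  then obtain w where "w \<in> lists X" "coords w = (\<lambda>p. min (coords u p) (coords v p))"
    using coords_surj by blast
  then show ?thesis
    by (intro bexI[of _ "pos w"]) (auto simp: uv divides_pos_iff isgcd_def le_fun_def)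
qed

lemma balanced_constant:
  assumes d: "d \<in> lists X" "coords d = (\<lambda>p. if p \<in> X then k else 0)"
  shows "P.balanced (pos d)"
proof -
  have "finite (pos ` {u. set u \<subseteq> X \<and> length u \<le> length d})"
    using finite_lists_length_le[OF fin] by blast
  moreover have "a \<in> pos ` {u. set u \<subseteq> X \<and> length u \<le> length d}"
    if a: "a \<in> carrier positive_monoid" "a divides\<^bsub>positive_monoid\<^esub> pos d" for a
  proof -
    obtain u where u: "u \<in> lists X" "a = pos u" using a(1) by auto
    have "deg a \<le> deg (pos d)" using P.divides_deg_le a by blast
    then show ?thesis using u d by (auto simp: deg_pos)
  qed
  ultimately have "finite {a \<in> carrier positive_monoid. a divides\<^bsub>positive_monoid\<^esub> pos d}"
    by (elim rev_finite_subset) blast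
  moreover have "a divides\<^bsub>positive_monoid\<^esub> pos d"
    if a: "a \<in> carrier positive_monoid" "a divides\<^bsub>opposite positive_monoid\<^esub> pos d" for a
  proof -
    obtain u where u: "u \<in> lists X" "a = pos u" using a(1) by auto
    obtain w where w: "w \<in> lists X" "pos d = pos w \<otimes>\<^bsub>G\<^esub> pos u"
      using a(2) u by (auto simp: factor_def)
    then have wu: "coords d = foldr shift w (coords u)"
      using u d pos_append[of w u] pos_eq_iff[of d "w @ u"] by (simp add: coords_append)
    have "coords u p \<le> coords d p" for p
    proof (cases "p \<in> X")
      case True
      then obtain q where "q \<in> X" "coords u p \<le> coords d q"
        using foldr_shift_dominates[OF w(1) True] wu by metis
      then show ?thesis using d True by simp
    next
      case False
      then show ?thesis using coords_orthant[OF u(1)] d by (simp add: orthant_def)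
    qed
    then show ?thesis using u d divides_pos_iff by (simp add: le_fun_def)
  qed
  ultimately show ?thesis using d(1) by (auto simp: P.balanced_def)
qed

lemma constant_word: "0 \<le> k \<Longrightarrow> \<exists>d\<in>lists X. coords d = (\<lambda>p. if p \<in> X then k else 0)"
  by (rule coords_surj) (auto simp: orthant_def)

lemma balanced_common_multiple:
  assumes "a \<in> carrier positive_monoid" "b \<in> carrier positive_monoid"
  shows "\<exists>d. P.balanced d \<and> a divides\<^bsub>positive_monoid\<^esub> d \<and> b divides\<^bsub>positive_monoid\<^esub> d"
proof -
  obtain u v where uv: "u \<in> lists X" "v \<in> lists X" "a = pos u" "b = pos v" using assms by auto
  \<comment> \<open>A coordinate of a word is at most its length.\<close>
  define k where "k = int (length u + length v)"
  obtain d where d: "d \<in> lists X" "coords d = (\<lambda>p. if p \<in> X then k else 0)"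
    using constant_word[of k] by (auto simp: k_def)
  have "coords w \<le> coords d" if "w \<in> lists X" "length w \<le> length u + length v" for w
    using coords_le_length[OF that(1)] that(2) coords_orthant[OF that(1)]
    by (force simp: le_fun_def d(2) k_def orthant_def intro: order_trans)
  then have "coords u \<le> coords d" "coords v \<le> coords d" using uv by auto
  then show ?thesis
    using balanced_constant[OF d] divides_pos_iff[OF _ d(1)] uv
    by (intro exI[of _ "pos d"]) simp
qed

lemma garside_positive_monoid: "garside_monoid positive_monoid"
proof -
  obtain d where d: "d \<in> lists X" "coords d = (\<lambda>p. if p \<in> X then 1 else 0)"
    using constant_word[of 1] by auto
  define D where "D = {a \<in> carrier positive_monoid. a divides\<^bsub>positive_monoid\<^esub> pos d}"
  have letter: "pos [x] \<in> D" if "x \<in> X" for x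
  proof -
    have "coords [x] \<le> coords d" using that d by (auto simp: le_fun_def shift_def)
    then show ?thesis using that d divides_pos_iff[of "[x]" d] by (auto simp: D_def)
  qed
  have "\<exists>as\<in>lists D. product positive_monoid as = pos u" if "u \<in> lists X" for u
    using that
  proof (induction u rule: list.induct)
    case Nil
    then show ?case by (intro bexI[of _ "[]"]) (auto simp: product_def pos_Nil)
  next
    case (Cons x u)
    then obtain as where "as \<in> lists D" "product positive_monoid as = pos u" by auto
    then show ?case
      using Cons.prems letter[of x] pos_append[of "[x]" u]
      by (intro bexI[of _ "pos [x] # as"]) (auto simp: product_def)
  qed
  then have "generates positive_monoid D" by (auto simp: generates_def D_def)
  then show ?thesis
    using P.garside_if_left_gcd_and_balanced[OF left_gcd_exists balanced_common_multiple
        balanced_constant[OF d]]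
    by (simp add: D_def)
qed

lemma common_right_multiple:
  assumes "u \<in> lists X" "v \<in> lists X"
  shows "\<exists>s\<in>lists X. \<exists>t\<in>lists X. pos u \<otimes>\<^bsub>G\<^esub> pos s = pos v \<otimes>\<^bsub>G\<^esub> pos t"
proof -
  have "pos u \<in> carrier positive_monoid" "pos v \<in> carrier positive_monoid"
    using assms by simp_all
  then obtain d where "pos u divides\<^bsub>positive_monoid\<^esub> d" "pos v divides\<^bsub>positive_monoid\<^esub> d"
    using balanced_common_multiple by blast
  then show ?thesis unfolding factor_def positive_simps by blast
qed

text \<open>
  The set of fractions contains the identity and is stable under left multiplication by letters and
  their inverses.  For \<open>x\<inverse> u v\<inverse>\<close>, a common multiple \<open>x s = u t\<close> gives \<open>s (v t)\<inverse>\<close>.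
\<close>

lemma fractions:
  assumes "g \<in> carrier G"
  shows "\<exists>u\<in>lists X. \<exists>v\<in>lists X. g = pos u \<otimes>\<^bsub>G\<^esub> inv\<^bsub>G\<^esub> pos v"
proof -
  have "\<exists>u\<in>lists X. \<exists>v\<in>lists X. group_cong `` {w} = pos u \<otimes>\<^bsub>G\<^esub> inv\<^bsub>G\<^esub> pos v"
    if "w \<in> lists (X \<times> UNIV)" for w
    using that
  proof (induction w rule: list.induct)
    case Nil
    have "group_cong `` {[]} = pos [] \<otimes>\<^bsub>G\<^esub> inv\<^bsub>G\<^esub> pos []"
      by (simp only: G_one[symmetric] pos_Nil G.inv_one G.l_one G.one_closed)
    then show ?case by (intro bexI[of _ "[]"]) simp_all
  next
    case (Cons l w)
    obtain x e where l: "l = (x, e)" "x \<in> X" using Cons.prems by auto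
    obtain u v where uv: "u \<in> lists X" "v \<in> lists X"
      and w: "group_cong `` {w} = pos u \<otimes>\<^bsub>G\<^esub> inv\<^bsub>G\<^esub> pos v"
      using Cons by auto
    have lw: "group_cong `` {l # w} = group_cong `` {[l]} \<otimes>\<^bsub>G\<^esub> group_cong `` {w}"
      using G_mult[of "[l]" w] Cons.prems by simp
    have x: "pos [x] \<in> carrier G" by (rule pos_closed) (use l in simp)
    note [simp] = pos_closed[OF uv(1)] pos_closed[OF uv(2)]
    show ?case
    proof (cases e)
      case True
      then have "group_cong `` {[l]} = pos [x]" by (simp add: pos_def l)
      then have "group_cong `` {l # w} = pos (x # u) \<otimes>\<^bsub>G\<^esub> inv\<^bsub>G\<^esub> pos v"
        using lw w x uv l pos_append[of "[x]" u, symmetric] by (simp add: G.m_assoc)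
      then show ?thesis using l uv by (intro bexI[of _ "x # u"] bexI[of _ v]) auto
    next
      case False
      have lG: "group_cong `` {[l]} \<in> carrier G"
        by (rule class_closed) (use l in simp)
      have "([(x, False), (x, True)], []) \<in> group_cong"
        using l by (intro word_cong.rel) (auto simp: group_relations_def)
      then have "group_cong `` {[l]} \<otimes>\<^bsub>G\<^esub> pos [x] = \<one>\<^bsub>G\<^esub>"
        using G_mult[of "[l]" "[(x, True)]"] l False equiv_class_eq[OF equiv_word_cong]
        by (simp add: pos_def G_one)
      then have inv: "inv\<^bsub>G\<^esub> pos [x] = group_cong `` {[l]}" using G.inv_equality x lG by blast
      obtain s t where st: "s \<in> lists X" "t \<in> lists X"
        "pos [x] \<otimes>\<^bsub>G\<^esub> pos s = pos u \<otimes>\<^bsub>G\<^esub> pos t"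
        using common_right_multiple[of "[x]" u] l uv by auto
      note [simp] = pos_closed[OF st(1)] pos_closed[OF st(2)]
      have "pos u = pos [x] \<otimes>\<^bsub>G\<^esub> pos s \<otimes>\<^bsub>G\<^esub> inv\<^bsub>G\<^esub> pos t"
        using st(3) x by (simp add: G.inv_solve_right)
      then have "inv\<^bsub>G\<^esub> pos [x] \<otimes>\<^bsub>G\<^esub> pos u = pos s \<otimes>\<^bsub>G\<^esub> inv\<^bsub>G\<^esub> pos t"
        using x by (simp add: G.inv_solve_left' G.m_assoc)
      then have "group_cong `` {l # w} = pos s \<otimes>\<^bsub>G\<^esub> (inv\<^bsub>G\<^esub> pos t \<otimes>\<^bsub>G\<^esub> inv\<^bsub>G\<^esub> pos v)"
        using lw w inv lG by (simp add: G.m_assoc[symmetric])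
      also have "\<dots> = pos s \<otimes>\<^bsub>G\<^esub> inv\<^bsub>G\<^esub> pos (v @ t)"
        using pos_append[of v t, symmetric] st uv by (simp add: G.inv_mult_group)
      finally show ?thesis using st uv by (intro bexI[of _ s] bexI[of _ "v @ t"]) auto
    qed
  qed
  then show ?thesis using assms by (auto simp: G_carrier)
qed

theorem garside_structure_group: "garside_group G"
proof -
  have "group_of_fractions G positive_monoid"
    unfolding group_of_fractions_def
  proof (intro conjI bexI[of _ "\<lambda>a. a"])
    show "group G" by (rule G.group_axioms)
    show "inj_on (\<lambda>a. a) (carrier positive_monoid)" by simp
    show "(\<lambda>a. a) \<in> hom positive_monoid G" using pos_closed by (auto simp: hom_def)
    show "\<forall>g\<in>carrier G. \<exists>a\<in>carrier positive_monoid. \<exists>b\<in>carrier positive_monoid.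
        g = a \<otimes>\<^bsub>G\<^esub> inv\<^bsub>G\<^esub> b"
      using fractions by auto
  qed simp
  then show ?thesis using garside_positive_monoid unfolding garside_group_def by blast
qed

end

section \<open>Counting and bijections of finite sets\<close>

lemma all_pairs_attained:
  assumes "finite X" "card R = card X * (card X - 1) div 2" "inj_on f R"
    and "\<And>r. r \<in> R \<Longrightarrow> f r \<subseteq> X \<and> card (f r) = 2"
  shows "f ` R = {A. A \<subseteq> X \<and> card A = 2}"
proof (rule card_subset_eq)
  show "finite {A. A \<subseteq> X \<and> card A = 2}" using assms(1) by simp
  show "f ` R \<subseteq> {A. A \<subseteq> X \<and> card A = 2}" using assms(4) by blast
  show "card (f ` R) = card {A. A \<subseteq> X \<and> card A = 2}"
    using assms(2) by (simp add: card_image[OF assms(3)] n_subsets[OF assms(1)] choose_two)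
qed

text \<open>
  If the exceptional value \<open>z\<close> were missed, injectivity away from \<open>z\<close> would embed \<open>X\<close> into
  \<open>X - {z}\<close>.
\<close>

lemma bij_betw_if_all_but_one:
  assumes fin: "finite X" and closed: "f ` X \<subseteq> X" and z: "z \<in> X"
    and surj: "\<And>y. y \<in> X \<Longrightarrow> y \<noteq> z \<Longrightarrow> y \<in> f ` X"
    and inj: "\<And>a b. a \<in> X \<Longrightarrow> b \<in> X \<Longrightarrow> f a = f b \<Longrightarrow> f a \<noteq> z \<Longrightarrow> a = b"
  shows "bij_betw f X X"
proof -
  have "z \<in> f ` X"
  proof (rule ccontr)
    assume z': "z \<notin> f ` X"
    then have "inj_on f X" using inj by (auto intro!: inj_onI)
    moreover have "f ` X \<subseteq> X - {z}" using closed z' by blast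
    ultimately have "card X \<le> card (X - {z})" using fin by (intro card_inj_on_le) auto
    then show False using fin z card_Diff1_less[of X z] by simp
  qed
  then have "f ` X = X" using surj closed by blast
  then show ?thesis using eq_card_imp_inj_on[OF fin, of f] by (simp add: bij_betw_def)
qed

text \<open>
  Two bijections that agree wherever the first avoids \<open>x\<close> and \<open>y\<close> can differ only by exchanging
  these two values.
\<close>

lemma bij_betw_agree:
  assumes P: "bij_betw P X X" and Q: "bij_betw Q X X" and xy: "x \<in> X" "y \<in> X"
    and agree: "\<And>c. c \<in> X \<Longrightarrow> P c \<noteq> x \<Longrightarrow> P c \<noteq> y \<Longrightarrow> Q c = P c"
    and no_swap: "\<And>c. c \<in> X \<Longrightarrow> P c = y \<Longrightarrow> Q c \<noteq> x"
    and c: "c \<in> X"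
  shows "P c = Q c"
proof -
  have Q_inj: "c = d" if "c \<in> X" "d \<in> X" "Q c = Q d" for c d
    using Q that by (auto simp: bij_betw_def inj_on_def)
  have two: "Q c = x \<or> Q c = y" if c: "c \<in> X" "P c = x \<or> P c = y" for c
  proof (rule ccontr)
    assume *: "\<not> (Q c = x \<or> Q c = y)"
    have "Q c \<in> X" using Q c(1) bij_betwE by blast
    then obtain d where d: "d \<in> X" "P d = Q c" using P by (metis bij_betw_imp_surj_on imageE)
    then have "Q d = Q c" using agree[of d] * by simp
    then have "d = c" using Q_inj d(1) c(1) by blast
    then show False using d c * by simp
  qed
  obtain d where d: "d \<in> X" "P d = y" using P xy(2) by (metis bij_betw_imp_surj_on imageE)
  have Qd: "Q d = y" using two[of d] no_swap[of d] d by auto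
  show ?thesis
  proof (cases "P c = y")
    case True
    then show ?thesis using two[OF c] no_swap[OF c] by simp
  next
    case False
    then have "c \<noteq> d" using d by blast
    then have "Q c \<noteq> y" using Q_inj[OF c d(1)] Qd by metis
    then show ?thesis using False two[OF c] agree[OF c] by metis
  qed
qed

section \<open>Garside monoids with quadratic relations\<close>

locale garside_presentation =
  fixes X :: "'a set" and R :: "('a list \<times> 'a list) set"
  assumes fin: "finite X" and nonempty: "X \<noteq> {}"
    and garside: "garside_monoid (presented_monoid X R)"
    and card_R: "card R = card X * (card X - 1) div 2"
    and quadratic: "\<forall>(u, v) \<in> R. u \<in> lists X \<and> length u = 2 \<and> v \<in> lists X \<and> length v = 2"
    and once: "\<forall>x\<in>X. \<forall>y\<in>X. [x, y] \<in> fst ` R \<union> snd ` R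
      \<longrightarrow> card {r \<in> R. fst r = [x, y]} + card {r \<in> R. snd r = [x, y]} = 1"
begin

abbreviation "W \<equiv> word_cong X R"
abbreviation "M \<equiv> presented_monoid X R"
abbreviation cls :: "'a list \<Rightarrow> 'a list set" where "cls u \<equiv> W `` {u}"

lemma finite_R: "finite R"
proof (rule finite_subset)
  show "R \<subseteq> {u. set u \<subseteq> X \<and> length u = 2} \<times> {u. set u \<subseteq> X \<and> length u = 2}"
    using quadratic by auto
qed (simp add: finite_lists_length_eq fin)

lemma relation_letters:
  assumes "(u, v) \<in> R"
  obtains x a y b where "u = [x, a]" "v = [y, b]" "x \<in> X" "a \<in> X" "y \<in> X" "b \<in> X"
proof -
  have "u \<in> lists X" "length u = 2" "v \<in> lists X" "length v = 2" using quadratic assms by auto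
  then show ?thesis using that by (auto simp: length_Suc_conv numeral_2_eq_2)
qed

lemma relation_once:
  assumes "(u, v) \<in> R"
  shows "(u, w) \<in> R \<Longrightarrow> w = v" "(w, v) \<in> R \<Longrightarrow> w = u" "(w, u) \<notin> R"
proof -
  have count: "card {r \<in> R. fst r = s} + card {r \<in> R. snd r = s} = 1"
    if "s \<in> fst ` R \<union> snd ` R" for s
  proof -
    from \<open>s \<in> _\<close> obtain r where "r \<in> R" "s = fst r \<or> s = snd r" by blast
    then obtain x y where "s = [x, y]" "x \<in> X" "y \<in> X"
      using relation_letters[of "fst r" "snd r"] by (metis prod.collapse)
    then show ?thesis using once \<open>s \<in> _\<close> by blast
  qed
  have card1: "r = r'" if "card A \<le> 1" "r \<in> A" "r' \<in> A" "A \<subseteq> R" for A and r r'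
    using that finite_subset[OF that(4) finite_R] by (metis card_le_Suc0_iff_eq One_nat_def)
  have "u \<in> fst ` R" "v \<in> snd ` R" using assms by force+
  then have cu: "card {r \<in> R. fst r = u} + card {r \<in> R. snd r = u} = 1"
    and cv: "card {r \<in> R. fst r = v} + card {r \<in> R. snd r = v} = 1" using count by blast+
  show "w = v" if "(u, w) \<in> R"
    using card1[of "{r \<in> R. fst r = u}" "(u, v)" "(u, w)"] cu that assms by auto
  show "w = u" if "(w, v) \<in> R"
    using card1[of "{r \<in> R. snd r = v}" "(u, v)" "(w, v)"] cv that assms by auto
  show "(w, u) \<notin> R"
  proof
    assume "(w, u) \<in> R"
    then have "{r \<in> R. fst r = u} \<noteq> {}" "{r \<in> R. snd r = u} \<noteq> {}" using assms by force+
    then have "card {r \<in> R. fst r = u} > 0" "card {r \<in> R. snd r = u} > 0"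
      using finite_R by (simp_all add: card_gt_0_iff)
    then show False using cu by simp
  qed
qed

definition edge :: "'a \<Rightarrow> 'a \<Rightarrow> 'a \<Rightarrow> 'a \<Rightarrow> bool"
  where "edge x a y b \<longleftrightarrow> ([x, a], [y, b]) \<in> R \<or> ([y, b], [x, a]) \<in> R"

lemma edge_sym: "edge x a y b \<Longrightarrow> edge y b x a"
  by (auto simp: edge_def)

lemma edge_in: "edge x a y b \<Longrightarrow> x \<in> X \<and> a \<in> X \<and> y \<in> X \<and> b \<in> X"
  by (auto simp: edge_def elim!: relation_letters)

lemma edge_unique: "edge x a y b \<Longrightarrow> edge x a y' b' \<Longrightarrow> y' = y \<and> b' = b"
  unfolding edge_def using relation_once by (metis list.inject)

lemma edge_irrefl: "\<not> edge x a x a"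
  unfolding edge_def using relation_once(3) by blast

lemma edge_cong: "edge x a y b \<Longrightarrow> ([x, a], [y, b]) \<in> W"
proof -
  assume e: "edge x a y b"
  then have "[x, a] \<in> lists X" "[y, b] \<in> lists X" using edge_in[OF e] by auto
  then show ?thesis using e unfolding edge_def by (blast intro: word_cong.rel word_cong.sym)
qed

text \<open>
  As every word of length two occurs at most once in \<open>R\<close>, the congruence classes of these words are
  the pairs in \<open>R\<close> and singletons.
\<close>

lemma short_words:
  assumes "(u, v) \<in> W"
  shows "length u = length v \<and> (length u \<le> 1 \<longrightarrow> u = v) \<and>
    (length u = 2 \<longrightarrow> u = v \<or> (u, v) \<in> R \<or> (v, u) \<in> R)"
  using assms
proof (induction rule: word_cong.induct)
  case (rel u v)
  then show ?case using quadratic by auto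
next
  case (trans u v w)
  have uv: "length u = length v" "length u \<le> 1 \<Longrightarrow> u = v"
      "length u = 2 \<Longrightarrow> u = v \<or> (u, v) \<in> R \<or> (v, u) \<in> R"
    and vw: "length v = length w" "length v \<le> 1 \<Longrightarrow> v = w"
      "length v = 2 \<Longrightarrow> v = w \<or> (v, w) \<in> R \<or> (w, v) \<in> R"
    using trans.IH by blast+
  have "u = w \<or> (u, w) \<in> R \<or> (w, u) \<in> R"
    if "u = v \<or> (u, v) \<in> R \<or> (v, u) \<in> R" "v = w \<or> (v, w) \<in> R \<or> (w, v) \<in> R"
    using that relation_once[of u v] relation_once[of v u] relation_once[of v w]
      relation_once[of w v] by blast
  then show ?case using uv vw by metis
next
  case (append u v u' v')
  have uv: "length u = length v" "length u \<le> 1 \<Longrightarrow> u = v"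
      "length u = 2 \<Longrightarrow> u = v \<or> (u, v) \<in> R \<or> (v, u) \<in> R"
    and uv': "length u' = length v'" "length u' \<le> 1 \<Longrightarrow> u' = v'"
      "length u' = 2 \<Longrightarrow> u' = v' \<or> (u', v') \<in> R \<or> (v', u') \<in> R"
    using append.IH by blast+
  show ?case
  proof (intro conjI impI)
    show "length (u @ u') = length (v @ v')" using uv(1) uv'(1) by simp
    show "u @ u' = v @ v'" if "length (u @ u') \<le> 1" using that uv(2) uv'(2) by simp
    assume len: "length (u @ u') = 2"
    then consider "length u = 0" "length u' = 2" | "length u = 2" "length u' = 0"
      | "length u = 1" "length u' = 1"
      by (cases "length u"; cases "length u'") (auto simp: numeral_2_eq_2)
    then show "u @ u' = v @ v' \<or> (u @ u', v @ v') \<in> R \<or> (v @ v', u @ u') \<in> R"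
    proof cases
      case 1
      then have "u = []" "v = []" using uv(1) by auto
      then show ?thesis using uv'(3)[OF 1(2)] by simp
    next
      case 2
      then have "u' = []" "v' = []" using uv'(1) by auto
      then show ?thesis using uv(3)[OF 2(1)] by simp
    next
      case 3
      then show ?thesis using uv(2) uv'(2) by simp
    qed
  qed
next
  case (refl u)
  then show ?case by simp
next
  case (sym u v)
  then show ?case by metis
qed

lemma cong_length: "(u, v) \<in> W \<Longrightarrow> length u = length v"
  by (rule short_words[THEN conjunct1])

lemma cong_letter: "([a], [b]) \<in> W \<Longrightarrow> a = b"
  using short_words[of "[a]" "[b]"] by simp

lemma cong_pair: "([x, a], [y, b]) \<in> W \<Longrightarrow> x = y \<and> a = b \<or> edge x a y b"
  using short_words[of "[x, a]" "[y, b]"] by (auto simp: edge_def)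

lemma cls_eq_iff: "u \<in> lists X \<Longrightarrow> v \<in> lists X \<Longrightarrow> cls u = cls v \<longleftrightarrow> (u, v) \<in> W"
  by (rule eq_equiv_class_iff[OF equiv_word_cong])

lemma cls_mult: "u \<in> lists X \<Longrightarrow> v \<in> lists X \<Longrightarrow> cls u \<otimes>\<^bsub>M\<^esub> cls v = cls (u @ v)"
  by (rule presented_monoid_mult)

lemma cls_carrier: "a \<in> carrier M \<longleftrightarrow> (\<exists>u\<in>lists X. a = cls u)"
  by (auto simp: presented_monoid_carrier)

lemma cls_closed: "u \<in> lists X \<Longrightarrow> cls u \<in> carrier M"
  unfolding cls_carrier by (rule bexI, rule HOL.refl)

definition deg :: "'a list set \<Rightarrow> nat"
  where "deg a = length (SOME u. u \<in> a)"

lemma deg_cls: "u \<in> lists X \<Longrightarrow> deg (cls u) = length u"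
proof -
  assume "u \<in> lists X"
  then have "u \<in> cls u" by (simp add: word_cong.refl)
  then have "(SOME v. v \<in> cls u) \<in> cls u" by (rule someI)
  then show ?thesis using cong_length[of u "SOME v. v \<in> cls u"] by (simp add: deg_def)
qed

interpretation M: graded_monoid M deg
proof -
  interpret monoid M by (rule monoid_presented_monoid)
  show "graded_monoid M deg"
  proof unfold_locales
    fix a b assume "a \<in> carrier M" "b \<in> carrier M"
    then obtain u v where "u \<in> lists X" "v \<in> lists X" "a = cls u" "b = cls v"
      unfolding cls_carrier by blast
    then show "deg (a \<otimes>\<^bsub>M\<^esub> b) = deg a + deg b"
      using cls_mult[of u v] deg_cls[of "u @ v"] by (simp add: deg_cls)
  next
    fix a assume "a \<in> carrier M" "deg a = 0"
    then obtain u where "u \<in> lists X" "a = cls u" "length u = 0"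
      unfolding cls_carrier using deg_cls by metis
    then show "a = \<one>\<^bsub>M\<^esub>" by (simp add: presented_monoid_def)
  qed
qed

interpretation op: graded_monoid "opposite M" deg
  by (rule graded_monoid_opposite) unfold_locales

interpretation M: monoid_cancel M
  using garside unfolding garside_monoid_def gaussian_monoid_def by blast

lemma right_lcm_exists: "a \<in> carrier M \<Longrightarrow> b \<in> carrier M \<Longrightarrow> \<exists>m\<in>carrier M. m lcmof\<^bsub>M\<^esub> a b"
  using garside unfolding garside_monoid_def gaussian_monoid_def right_lcm_def by blast

lemma left_lcm_exists:
  "a \<in> carrier M \<Longrightarrow> b \<in> carrier M \<Longrightarrow> \<exists>m\<in>carrier M. m lcmof\<^bsub>opposite M\<^esub> a b"
  using garside unfolding garside_monoid_def gaussian_monoid_def left_lcm_def by blast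

lemma cong_cancel_left:
  assumes "u \<in> lists X" "v \<in> lists X" "w \<in> lists X" "(w @ u, w @ v) \<in> W"
  shows "(u, v) \<in> W"
proof -
  have "cls w \<otimes>\<^bsub>M\<^esub> cls u = cls w \<otimes>\<^bsub>M\<^esub> cls v"
    using assms cls_mult[of w u] cls_mult[of w v] cls_eq_iff[of "w @ u" "w @ v"] by simp
  then have "cls u = cls v" using M.l_cancel assms(1-3) cls_closed by blast
  then show ?thesis using assms(1,2) cls_eq_iff by blast
qed

lemma cong_cancel_right:
  assumes "u \<in> lists X" "v \<in> lists X" "w \<in> lists X" "(u @ w, v @ w) \<in> W"
  shows "(u, v) \<in> W"
proof -
  have "cls u \<otimes>\<^bsub>M\<^esub> cls w = cls v \<otimes>\<^bsub>M\<^esub> cls w"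
    using assms cls_mult[of u w] cls_mult[of v w] cls_eq_iff[of "u @ w" "v @ w"] by simp
  then have "cls u = cls v" using M.r_cancel assms(1-3) cls_closed by blast
  then show ?thesis using assms(1,2) cls_eq_iff by blast
qed

lemma edge_fst_neq: "edge x a y b \<Longrightarrow> x \<noteq> y"
proof
  assume e: "edge x a y b" and "x = y"
  then have "([a], [b]) \<in> W"
    using cong_cancel_left[of "[a]" "[b]" "[x]"] edge_cong[OF e] edge_in[OF e] by simp
  then show False using e \<open>x = y\<close> cong_letter edge_irrefl by blast
qed

lemma edge_snd_neq: "edge x a y b \<Longrightarrow> a \<noteq> b"
proof
  assume e: "edge x a y b" and "a = b"
  then have "([x], [y]) \<in> W"
    using cong_cancel_right[of "[x]" "[y]" "[a]"] edge_cong[OF e] edge_in[OF e] by simp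
  then show False using e \<open>a = b\<close> cong_letter edge_irrefl by blast
qed

lemma cls_divides:
  "u \<in> lists X \<Longrightarrow> v \<in> lists X \<Longrightarrow> cls u divides\<^bsub>M\<^esub> cls (u @ v)"
  "u \<in> lists X \<Longrightarrow> v \<in> lists X \<Longrightarrow> cls v divides\<^bsub>opposite M\<^esub> cls (u @ v)"
  unfolding factor_def opposite_simps
  by (rule bexI[of _ "cls v"], simp_all only: cls_mult cls_closed)
    (rule bexI[of _ "cls u"], simp_all only: cls_mult cls_closed)

lemma letters_neq: "x \<in> X \<Longrightarrow> y \<in> X \<Longrightarrow> x \<noteq> y \<Longrightarrow> cls [x] \<noteq> cls [y]"
  using cls_eq_iff[of "[x]" "[y]"] cong_letter by auto

lemma edge_cls: "edge x a y b \<Longrightarrow> cls [x, a] = cls [y, b]"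
  using cls_eq_iff[of "[x, a]" "[y, b]"] edge_cong edge_in[of x a y b] by simp

lemma edge_is_right_lcm:
  assumes e: "edge x a y b" and m: "m \<in> carrier M" "m lcmof\<^bsub>M\<^esub> cls [x] cls [y]"
  shows "m = cls [x, a]"
proof -
  have X: "x \<in> X" "a \<in> X" "y \<in> X" "b \<in> X" using edge_in[OF e] by auto
  show ?thesis
  proof (rule M.lcm_of_degree_one[OF _ _ _ _ _ m])
    show "cls [x] divides\<^bsub>M\<^esub> cls [x, a]" using cls_divides(1)[of "[x]" "[a]"] X by simp
    show "cls [y] divides\<^bsub>M\<^esub> cls [x, a]"
      unfolding edge_cls[OF e] using cls_divides(1)[of "[y]" "[b]"] X by simp
  qed (use X edge_fst_neq[OF e] letters_neq in \<open>simp_all add: deg_cls cls_closed\<close>)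
qed

lemma edge_is_left_lcm:
  assumes e: "edge x a y b" and m: "m \<in> carrier M" "m lcmof\<^bsub>opposite M\<^esub> cls [a] cls [b]"
  shows "m = cls [x, a]"
proof -
  have X: "x \<in> X" "a \<in> X" "y \<in> X" "b \<in> X" using edge_in[OF e] by auto
  show ?thesis
  proof (rule op.lcm_of_degree_one[OF _ _ _ _ _ _ m(2)])
    show "cls [a] divides\<^bsub>opposite M\<^esub> cls [x, a]" using cls_divides(2)[of "[x]" "[a]"] X by simp
    show "cls [b] divides\<^bsub>opposite M\<^esub> cls [x, a]"
      unfolding edge_cls[OF e] using cls_divides(2)[of "[y]" "[b]"] X by simp
  qed (use X m(1) edge_snd_neq[OF e] letters_neq in \<open>simp_all add: deg_cls cls_closed\<close>)
qed

text \<open>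
  A relation \<open>x a = y b\<close> expresses the right lcm of \<open>x\<close> and \<open>y\<close>, which left divides all their common
  right multiples.
\<close>

lemma right_multiple_of_edge:
  assumes e: "edge x a y b" and pq: "p \<in> lists X" "q \<in> lists X" "(x # p, y # q) \<in> W"
  shows "\<exists>r\<in>lists X. (p, a # r) \<in> W"
proof -
  have X: "x \<in> X" "a \<in> X" "y \<in> X" "b \<in> X" using edge_in[OF e] by auto
  obtain m where m: "m \<in> carrier M" "m lcmof\<^bsub>M\<^esub> cls [x] cls [y]"
    using right_lcm_exists[of "cls [x]" "cls [y]"] X cls_closed by auto
  have "cls (x # p) = cls (y # q)" using cls_eq_iff[of "x # p" "y # q"] pq X by simp
  then have "cls [x] divides\<^bsub>M\<^esub> cls (x # p)" "cls [y] divides\<^bsub>M\<^esub> cls (x # p)"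
    using cls_divides(1)[of "[x]" p] cls_divides(1)[of "[y]" q] X pq by auto
  moreover have "cls (x # p) \<in> carrier M" using X pq by (intro cls_closed) simp
  ultimately have "cls [x, a] divides\<^bsub>M\<^esub> cls (x # p)"
    using m edge_is_right_lcm[OF e m] unfolding islcm_def by blast
  then obtain c where c: "c \<in> carrier M" "cls (x # p) = cls [x, a] \<otimes>\<^bsub>M\<^esub> c"
    unfolding factor_def by blast
  obtain r where r: "r \<in> lists X" "c = cls r" using c(1) unfolding cls_carrier by blast
  then have "([x] @ p, [x] @ (a # r)) \<in> W"
    using c(2) cls_mult[of "[x, a]" r] cls_eq_iff[of "x # p" "x # a # r"] X pq by simp
  then have "(p, a # r) \<in> W" using X pq r by (intro cong_cancel_left[of p "a # r" "[x]"]) auto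
  then show ?thesis using r by blast
qed

lemma edge_by_fst:
  assumes "edge x a y b" "edge x a' y b'"
  shows "a = a'"
proof -
  have X: "x \<in> X" "a \<in> X" "a' \<in> X" "y \<in> X" using assms edge_in by auto
  obtain m where m: "m \<in> carrier M" "m lcmof\<^bsub>M\<^esub> cls [x] cls [y]"
    using right_lcm_exists[of "cls [x]" "cls [y]"] X cls_closed by auto
  have "cls [x, a] = cls [x, a']"
    using edge_is_right_lcm[OF assms(1) m] edge_is_right_lcm[OF assms(2) m] by simp
  then have "([x, a], [x, a']) \<in> W" using cls_eq_iff[of "[x, a]" "[x, a']"] X by simp
  then show ?thesis using cong_pair edge_fst_neq by blast
qed

lemma edge_by_snd:
  assumes "edge x a y b" "edge x' a y' b"
  shows "x = x'"
proof -
  have X: "x \<in> X" "a \<in> X" "x' \<in> X" "b \<in> X" using assms edge_in by auto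
  obtain m where m: "m \<in> carrier M" "m lcmof\<^bsub>opposite M\<^esub> cls [a] cls [b]"
    using left_lcm_exists[of "cls [a]" "cls [b]"] X cls_closed by auto
  have "cls [x, a] = cls [x', a]"
    using edge_is_left_lcm[OF assms(1) m] edge_is_left_lcm[OF assms(2) m] by simp
  then have "([x, a], [x', a]) \<in> W" using cls_eq_iff[of "[x, a]" "[x', a]"] X by simp
  then show ?thesis using cong_pair edge_snd_neq by blast
qed

lemma relation_edge:
  assumes "r \<in> R"
  obtains x a y b where "r = ([x, a], [y, b])" "edge x a y b"
proof (cases r)
  case (Pair u v)
  then have uv: "(u, v) \<in> R" using assms by simp
  show ?thesis
    by (rule relation_letters[OF uv]) (use that uv Pair in \<open>simp add: edge_def\<close>)
qed

text \<open>
  Sending a relation to the two letters at a fixed position of its sides is injective into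
  the two-element subsets of \<open>X\<close>, hence surjective, because there are exactly as many of these.  The
  position enters as a projection \<open>pr\<close>, so that the first and the last letters are treated alike.
\<close>

lemma edge_exists:
  fixes pr :: "'a \<times> 'a \<Rightarrow> 'a"
  assumes pr_in: "\<And>x a. pr (x, a) \<in> {x, a}"
    and pr_neq: "\<And>x a y b. edge x a y b \<Longrightarrow> pr (x, a) \<noteq> pr (y, b)"
    and det: "\<And>x a y b x' a' y' b'. edge x a y b \<Longrightarrow> edge x' a' y' b' \<Longrightarrow>
      pr (x, a) = pr (x', a') \<Longrightarrow> pr (y, b) = pr (y', b') \<Longrightarrow> (x, a) = (x', a')"
    and st: "s \<in> X" "t \<in> X" "s \<noteq> t"
  shows "\<exists>x a y b. edge x a y b \<and> pr (x, a) = s \<and> pr (y, b) = t"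
proof -
  define pair :: "'a list \<Rightarrow> 'a \<times> 'a" where "pair u = (hd u, last u)" for u
  define f where "f r = {pr (pair (fst r)), pr (pair (snd r))}" for r
  have f: "f ([x, a], [y, b]) = {pr (x, a), pr (y, b)}" for x a y b by (simp add: f_def pair_def)
  have "f ` R = {A. A \<subseteq> X \<and> card A = 2}"
  proof (rule all_pairs_attained[OF fin card_R])
    fix r assume "r \<in> R"
    then obtain x a y b where r: "r = ([x, a], [y, b])" and e: "edge x a y b"
      by (rule relation_edge)
    have "pr (x, a) \<in> X" "pr (y, b) \<in> X"
      using pr_in[of x a] pr_in[of y b] edge_in[OF e] by auto
    then show "f r \<subseteq> X \<and> card (f r) = 2" using pr_neq[OF e] by (simp add: r f)
  next
    show "inj_on f R"
    proof (rule inj_onI)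
      fix r s assume rR: "r \<in> R" and sR: "s \<in> R" and eq: "f r = f s"
      obtain x a y b where r: "r = ([x, a], [y, b])" and er: "edge x a y b"
        using rR by (rule relation_edge)
      obtain x' a' y' b' where s: "s = ([x', a'], [y', b'])" and es: "edge x' a' y' b'"
        using sR by (rule relation_edge)
      from eq consider "pr (x, a) = pr (x', a')" "pr (y, b) = pr (y', b')"
        | "pr (x, a) = pr (y', b')" "pr (y, b) = pr (x', a')"
        by (auto simp: r s f doubleton_eq_iff)
      then show "r = s"
      proof cases
        case 1
        then have "[x, a] = [x', a']" using det[OF er es] by simp
        then show ?thesis using relation_once(1)[of "[x, a]" "[y, b]" "[y', b']"] rR sR
          by (simp add: r s)
      next
        case 2
        then have "[x, a] = [y', b']" using det[OF er edge_sym[OF es]] by simp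
        then show ?thesis using relation_once(3)[of "[x, a]" "[y, b]" "[x', a']"] rR sR
          by (simp add: r s)
      qed
    qed
  qed
  moreover have "{s, t} \<in> {A. A \<subseteq> X \<and> card A = 2}" using st by simp
  ultimately obtain r where r: "r \<in> R" "f r = {s, t}" by (metis imageE)
  obtain x a y b where r': "r = ([x, a], [y, b])" and e: "edge x a y b"
    using r(1) by (rule relation_edge)
  have "pr (x, a) = s \<and> pr (y, b) = t \<or> pr (x, a) = t \<and> pr (y, b) = s"
    using r(2) by (auto simp: r' f doubleton_eq_iff)
  then show ?thesis using e edge_sym by blast
qed

lemma edge_exists_fst: "x \<in> X \<Longrightarrow> y \<in> X \<Longrightarrow> x \<noteq> y \<Longrightarrow> \<exists>a b. edge x a y b"
  using edge_exists[of fst x y] edge_fst_neq edge_by_fst by fastforce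

lemma edge_exists_snd: "a \<in> X \<Longrightarrow> b \<in> X \<Longrightarrow> a \<noteq> b \<Longrightarrow> \<exists>x y. edge x a y b"
  using edge_exists[of snd a b] edge_snd_neq edge_by_snd by fastforce

definition S :: "'a \<times> 'a \<Rightarrow> 'a \<times> 'a"
  where "S p = (if \<exists>q. edge (fst p) (snd p) (fst q) (snd q)
    then (SOME q. edge (fst p) (snd p) (fst q) (snd q)) else p)"

lemma S_edge: "edge x a y b \<Longrightarrow> S (x, a) = (y, b)"
proof -
  assume e: "edge x a y b"
  have ex: "\<exists>q. edge x a (fst q) (snd q)" using e by (intro exI[of _ "(y, b)"]) simp
  then have "edge x a (fst (S (x, a))) (snd (S (x, a)))"
    unfolding S_def fst_conv snd_conv if_P[OF ex] by (rule someI_ex)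
  then show ?thesis using edge_unique[OF e] by (metis prod.collapse)
qed

lemma S_cases: "S (x, a) = (y, b) \<Longrightarrow> edge x a y b \<or> y = x \<and> b = a"
proof (cases "\<exists>y b. edge x a y b")
  case True
  assume "S (x, a) = (y, b)"
  then show ?thesis using True S_edge by (metis prod.inject)
next
  case False
  assume "S (x, a) = (y, b)"
  then show ?thesis using False by (simp add: S_def)
qed

lemma S_closed: "p \<in> X \<times> X \<Longrightarrow> S p \<in> X \<times> X"
  using S_cases[of "fst p" "snd p" "fst (S p)" "snd (S p)"] edge_in by (auto simp: mem_Times_iff)

lemma S_involutive: "S (S p) = p"
proof -
  obtain x a y b where p: "p = (x, a)" "S (x, a) = (y, b)" by (metis prod.collapse)
  then show ?thesis using S_cases[OF p(2)] S_edge edge_sym by metis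
qed

lemma solution: "set_solution X S"
  unfolding set_solution_def
proof
  have "S ` (X \<times> X) \<subseteq> X \<times> X" by (intro image_subsetI S_closed)
  moreover have "\<forall>p\<in>X \<times> X. S (S p) = p" by (intro ballI S_involutive)
  ultimately show "bij_betw S (X \<times> X) (X \<times> X)"
    by (intro bij_betw_byWitness[where f' = S])
qed (rule nonempty)

text \<open>
  Relations provide each value other than \<open>z\<close> exactly once, and the value \<open>z\<close> is left for the words
  that \<open>S\<close> fixes.
\<close>

lemma non_degenerate: "non_degenerate X S"
  unfolding non_degenerate_def
proof (intro conjI ballI)
  fix z assume z: "z \<in> X"
  show "bij_betw (\<lambda>a. fst (S (z, a))) X X"
  proof (rule bij_betw_if_all_but_one[OF fin _ z])
    show "(\<lambda>a. fst (S (z, a))) ` X \<subseteq> X" using S_closed z by (auto simp: mem_Times_iff)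
    show "y \<in> (\<lambda>a. fst (S (z, a))) ` X" if y: "y \<in> X" "y \<noteq> z" for y
    proof -
      obtain a b where e: "edge z a y b" using edge_exists_fst[of z y] z y by blast
      then show ?thesis using S_edge[OF e] edge_in[OF e] by (intro image_eqI[of _ _ a]) auto
    qed
    show "a = b" if ab: "fst (S (z, a)) = fst (S (z, b))" "fst (S (z, a)) \<noteq> z" for a b
    proof -
      obtain y a' b' where S: "S (z, a) = (y, a')" "S (z, b) = (y, b')" "y \<noteq> z"
        using ab by (metis prod.collapse)
      then have "edge z a y a'" "edge z b y b'" using S_cases by blast+
      then show ?thesis by (rule edge_by_fst)
    qed
  qed
next
  fix z assume z: "z \<in> X"
  show "bij_betw (\<lambda>x. snd (S (x, z))) X X"
  proof (rule bij_betw_if_all_but_one[OF fin _ z])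
    show "(\<lambda>x. snd (S (x, z))) ` X \<subseteq> X" using S_closed z by (auto simp: mem_Times_iff)
    show "b \<in> (\<lambda>x. snd (S (x, z))) ` X" if b: "b \<in> X" "b \<noteq> z" for b
    proof -
      obtain x y where e: "edge x z y b" using edge_exists_snd[of z b] z b by blast
      then show ?thesis using S_edge[OF e] edge_in[OF e] by (intro image_eqI[of _ _ x]) auto
    qed
    show "x = y" if xy: "snd (S (x, z)) = snd (S (y, z))" "snd (S (x, z)) \<noteq> z" for x y
    proof -
      obtain b x' y' where S: "S (x, z) = (x', b)" "S (y, z) = (y', b)" "b \<noteq> z"
        using xy by (metis prod.collapse)
      then have "edge x z x' b" "edge y z y' b" using S_cases by blast+
      then show ?thesis by (rule edge_by_snd)
    qed
  qed
qed

interpretation sol: involutive_solution X S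
  using solution non_degenerate S_involutive by unfold_locales (simp_all add: involutive_def)

lemma S_cong: "x \<in> X \<Longrightarrow> a \<in> X \<Longrightarrow> S (x, a) = (y, b) \<Longrightarrow> ([x, a], [y, b]) \<in> W"
  using S_cases[of x a y b] edge_cong by (auto intro: word_cong.refl)

lemma perm_edge: "edge x a y b \<Longrightarrow> sol.perm x a = y"
  using S_edge edge_in[of x a y b] by (simp add: sol.perm_def)

text \<open>
  Put \<open>m = \<sigma>\<^sub>a(c)\<close> and \<open>z = \<sigma>\<^sub>x(m)\<close>.  The word \<open>y b c\<close>, equal to \<open>x a c\<close>, is also a right multiple of
  \<open>z\<close>, hence of the lcm \<open>y g\<close> of \<open>y\<close> and \<open>z\<close>.  Cancelling \<open>y\<close>, the word \<open>b c\<close> is a multiple of \<open>g\<close>,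
  so that \<open>\<sigma>\<^sub>b(c) = g\<close> and \<open>\<sigma>\<^sub>y(g) = z\<close>.
\<close>

lemma perm_agree:
  assumes e: "edge x a y b" and c: "c \<in> X"
    and z: "sol.perm x (sol.perm a c) \<noteq> x" "sol.perm x (sol.perm a c) \<noteq> y"
  shows "sol.perm y (sol.perm b c) = sol.perm x (sol.perm a c)"
proof -
  have X: "x \<in> X" "a \<in> X" "y \<in> X" "b \<in> X" using edge_in[OF e] by auto
  obtain m m' where m: "S (a, c) = (m, m')" by force
  have pm: "sol.perm a c = m" "m \<in> X" "m' \<in> X" using sol.perm_S[OF X(2) c m] by auto
  obtain z d where zd: "S (x, m) = (z, d)" by force
  have pz: "sol.perm x m = z" "z \<in> X" "d \<in> X" using sol.perm_S[OF X(1) pm(2) zd] by auto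
  have xz: "x \<noteq> z" "y \<noteq> z" using z pm pz by auto
  have app: "(u @ s @ v, u @ t @ v) \<in> W" if "u \<in> lists X" "v \<in> lists X" "(s, t) \<in> W" for u v s t
    using that by (intro word_cong.append word_cong.refl)
  have 1: "([y, b, c], [x, a, c]) \<in> W"
    using app[of "[]" "[c]", OF _ _ edge_cong[OF edge_sym[OF e]]] c by simp
  have 2: "([x, a, c], [x, m, m']) \<in> W"
    using app[of "[x]" "[]", OF _ _ S_cong[OF X(2) c m]] X by simp
  have 3: "([x, m, m'], [z, d, m']) \<in> W"
    using app[of "[]" "[m']", OF _ _ S_cong[OF X(1) pm(2) zd]] pm by simp
  have yz: "(y # [b, c], z # [d, m']) \<in> W"
    by (rule word_cong.trans[OF 1 word_cong.trans[OF 2 3]])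
  obtain g h where gh: "edge y g z h" using edge_exists_fst[OF X(3) pz(2) xz(2)] by blast
  obtain r where r: "([b, c], g # r) \<in> W"
    using right_multiple_of_edge[OF gh _ _ yz] X c pz pm by auto
  then obtain r' where r': "r = [r']" using cong_length[OF r] by (cases r; cases "tl r") auto
  \<comment> \<open>Otherwise \<open>y b\<close> would be related to words beginning with \<open>x\<close> and with \<open>z\<close>.\<close>
  have "b \<noteq> g" using edge_unique[OF edge_sym[OF e], of z h] gh xz by blast
  then have "edge b c g r'" using cong_pair r r' by blast
  then show ?thesis using perm_edge gh pm pz by simp
qed

lemma perm_law: "sol.perm_law"
  unfolding sol.perm_law_def
proof (intro ballI allI impI ext)
  fix x a y b c assume X: "x \<in> X" "a \<in> X" and S: "S (x, a) = (y, b)"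
  show "(sol.perm x \<circ> sol.perm a) c = (sol.perm y \<circ> sol.perm b) c"
  proof (cases "edge x a y b \<and> c \<in> X")
    case True
    then have e: "edge x a y b" and c: "c \<in> X" by auto
    have Y: "y \<in> X" "b \<in> X" using edge_in[OF e] by auto
    have bij: "bij_betw (sol.perm s \<circ> sol.perm t) X X" if "s \<in> X" "t \<in> X" for s t
      using bij_betw_trans sol.bij_betw_perm that by blast
    show ?thesis
    proof (rule bij_betw_agree[OF bij[OF X] bij[OF Y] X(1) Y(1) _ _ c])
      fix c assume c: "c \<in> X"
      show "(sol.perm y \<circ> sol.perm b) c = (sol.perm x \<circ> sol.perm a) c"
        if "(sol.perm x \<circ> sol.perm a) c \<noteq> x" "(sol.perm x \<circ> sol.perm a) c \<noteq> y"
        using perm_agree[OF e c] that by simp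
      show "(sol.perm y \<circ> sol.perm b) c \<noteq> x" if xa: "(sol.perm x \<circ> sol.perm a) c = y"
      proof
        \<comment> \<open>In this case \<open>S\<close> fixes both \<open>(a, c)\<close> and \<open>(b, c)\<close>, against non-degeneracy on the right.\<close>
        assume yb: "(sol.perm y \<circ> sol.perm b) c = x"
        have "sol.perm a c = a"
          using sol.perm_inj[OF X(1), of "sol.perm a c" a] xa perm_edge[OF e] by simp
        moreover have "sol.perm b c = b"
          using sol.perm_inj[OF Y(1), of "sol.perm b c" b] yb perm_edge[OF edge_sym[OF e]] by simp
        ultimately have "snd (S (a, c)) = c" "snd (S (b, c)) = c"
          using S_cases[of a c a "snd (S (a, c))"] S_cases[of b c b "snd (S (b, c))"]
            edge_fst_neq c by (auto simp: sol.perm_def prod_eq_iff)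
        moreover have "inj_on (\<lambda>x. snd (S (x, c))) X"
          using non_degenerate c unfolding non_degenerate_def bij_betw_def by blast
        ultimately have "a = b" using inj_onD[of _ X a b] X(2) Y(2) by metis
        then show False using edge_snd_neq[OF e] by simp
      qed
    qed
  next
    case False
    then show ?thesis using S_cases[OF S] X S_closed[of "(x, a)"] S by (auto simp: sol.perm_def)
  qed
qed

lemma braided: "braided X S"
  by (rule sol.braided_if_perm_law[OF perm_law])

end

lemma word_cong_least:
  assumes "\<And>u v. (u, v) \<in> Q \<Longrightarrow> u \<in> lists Y \<Longrightarrow> v \<in> lists Y \<Longrightarrow> (u, v) \<in> word_cong Y Q'"
    and "(u, v) \<in> word_cong Y Q"
  shows "(u, v) \<in> word_cong Y Q'"
  using assms(2)
  by (induction rule: word_cong.induct)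
    (blast intro: assms(1) word_cong.refl word_cong.sym word_cong.trans word_cong.append)+

lemma presented_group_eq:
  assumes "\<And>u v. (u, v) \<in> Q \<Longrightarrow> (u, v) \<in> word_cong X Q'"
    and "\<And>u v. (u, v) \<in> Q' \<Longrightarrow> (u, v) \<in> word_cong X Q"
  shows "presented_group X Q = presented_group X Q'"
proof -
  have "word_cong (X \<times> UNIV) (group_relations X Q) \<subseteq> word_cong (X \<times> UNIV) (group_relations X Q')"
    if Q: "\<And>u v. (u, v) \<in> Q \<Longrightarrow> (u, v) \<in> word_cong X Q'" for Q Q'
  proof (rule subrelI, erule word_cong_least[rotated])
    fix u v
    assume uv: "(u, v) \<in> group_relations X Q" "u \<in> lists (X \<times> UNIV)" "v \<in> lists (X \<times> UNIV)"
    then consider s t where "(s, t) \<in> Q" "u = map (\<lambda>x. (x, True)) s" "v = map (\<lambda>x. (x, True)) t"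
      | "(u, v) \<in> group_relations X Q'"
      by (auto simp: group_relations_def)
    then show "(u, v) \<in> word_cong (X \<times> UNIV) (group_relations X Q')"
    proof cases
      case 1
      then show ?thesis using word_cong_group_relations[OF Q] by simp
    next
      case 2
      then show ?thesis using uv by (intro word_cong.rel)
    qed
  qed
  then have "word_cong (X \<times> UNIV) (group_relations X Q)
      = word_cong (X \<times> UNIV) (group_relations X Q')"
    using assms by blast
  then show ?thesis by (simp add: presented_group_def presented_monoid_def)
qed

context garside_presentation
begin

lemma presented_group_is_structure_group: "presented_group X R = structure_group X S"
  unfolding structure_group_def
proof (rule presented_group_eq)
  fix u v assume "(u, v) \<in> R"
  then obtain x a y b where "u = [x, a]" "v = [y, b]" "x \<in> X" "a \<in> X" "y \<in> X" "b \<in> X"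
    "edge x a y b"
    by (metis relation_letters edge_def)
  then show "(u, v) \<in> word_cong X (structure_relations X S)"
    using S_edge by (intro word_cong.rel) (auto simp: structure_relations_def)
next
  fix u v assume "(u, v) \<in> structure_relations X S"
  then show "(u, v) \<in> word_cong X R" using S_cong by (auto simp: structure_relations_def)
qed

end

theorem theorem1:
  shows "(\<forall>(X :: 'a set) S.
      finite X \<and> set_solution X S \<and> non_degenerate X S \<and> involutive X S \<and> braided X S
      \<longrightarrow> garside_group (structure_group X S))
    \<and>
    (\<forall>(X :: 'a set) (R :: ('a list \<times> 'a list) set) n.
      finite X \<and> X \<noteq> {} \<and> card X = n
      \<and> garside_monoid (presented_monoid X R)
      \<and> card R = n * (n - 1) div 2
      \<and> (\<forall>(u, v) \<in> R. u \<in> lists X \<and> length u = 2 \<and> v \<in> lists X \<and> length v = 2)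
      \<and> (\<forall>x\<in>X. \<forall>y\<in>X. [x, y] \<in> fst ` R \<union> snd ` R
            \<longrightarrow> card {r \<in> R. fst r = [x, y]} + card {r \<in> R. snd r = [x, y]} = 1)
      \<longrightarrow> (\<exists>S :: 'a \<times> 'a \<Rightarrow> 'a \<times> 'a.
            set_solution X S \<and> non_degenerate X S \<and> involutive X S \<and> braided X S
            \<and> presented_group X R = structure_group X S))"
proof (intro conjI allI impI)
  fix X :: "'a set" and S
  assume "finite X \<and> set_solution X S \<and> non_degenerate X S \<and> involutive X S \<and> braided X S"
  then interpret braided_solution X S by unfold_locales auto
  show "garside_group (structure_group X S)" by (rule garside_structure_group)
next
  fix X :: "'a set" and R :: "('a list \<times> 'a list) set" and n
  assume "finite X \<and> X \<noteq> {} \<and> card X = n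
      \<and> garside_monoid (presented_monoid X R)
      \<and> card R = n * (n - 1) div 2
      \<and> (\<forall>(u, v) \<in> R. u \<in> lists X \<and> length u = 2 \<and> v \<in> lists X \<and> length v = 2)
      \<and> (\<forall>x\<in>X. \<forall>y\<in>X. [x, y] \<in> fst ` R \<union> snd ` R
            \<longrightarrow> card {r \<in> R. fst r = [x, y]} + card {r \<in> R. snd r = [x, y]} = 1)"
  then interpret garside_presentation X R by unfold_locales auto
  show "\<exists>S :: 'a \<times> 'a \<Rightarrow> 'a \<times> 'a.
      set_solution X S \<and> non_degenerate X S \<and> involutive X S \<and> braided X S
      \<and> presented_group X R = structure_group X S"
    using solution non_degenerate S_involutive braided presented_group_is_structure_group
    by (intro exI[of _ S]) (simp add: involutive_def)
qed

end
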